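(* Let $\omega_0\in\mathbb{R}$ and let $\mathcal{S}_{\omega_0}$ and $\mathcal{N}_{\omega_0}$ be the sets defined in the context. (a) If the network equations are not satisfied, i.e. $(i_s,v,i_T)\notin\mathcal{N}_{\omega_0}$, then there exist no machine states $(\theta,\omega,i)$ (with stator currents $i_s$) and no machine inputs $u$ such that $(\theta,\omega,i,v,i_T,u)\in\mathcal{S}_{\omega_0}$. (b) Conversely, for every $(i_s,v,i_T)\in\mathcal{N}_{\omega_0}$ there exist $(\theta,\omega,i)$ (with stator currents $i_s$) and $u$ such that $(\theta,\omega,i,v,i_T,u)\in\mathcal{S}_{\omega_0}$. (c) In particular, given $(i_s,v,i_T)\in\mathcal{N}_{\omega_0}$, all corresponding $(\theta,\omega,i,u)$ such that $(\theta,\omega,i,v,i_T,u)\in\mathcal{S}_{\omega_0}$ satisfy, for every $k\in\{1,\dots,n_g\}$ and with corresponding rotor polarization $\sigma_k\in\{-1,1\}$, $$\omega_0\,l_{sf,k}\,i_{f,k}=\sigma_k\|\nu_k(\theta_k)\|,\qquad j\,\mathrm{r}(\theta_k)\,\|\nu_k(\theta_k)\|=\sigma_k\,\nu_k(\theta_k),$$ as well as $\omega_k=\omega_0$, $i_{d,k}=i_{q,k}=0$, and $$v_{f,k}=r_{f,k}\,i_{f,k},\qquad \tau_{m,k}=d_k\,\omega_0+\tau_{e,k},$$ where $\tau_{e,k}=\tfrac12 i_k^\top\big(L_k(\theta_k)\mathsf{J}+\mathsf{J}^\top L_k(\theta_k)\big)i_k$ and $\nu_k(\theta_k)=v_k-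\big(r_{s,k}I_2+\omega_0\,j\,L_{s,k}(\theta_k)\big)i_{s,k}$.
   Context: Notation. $(a,b)$ denotes stacked column vectors; $\mathrm{diag}$ denotes (block-)diagonal matrices; $\otimes$ is the Kronecker product; $\|\cdot\|$ is the Euclidean norm. $\mathrm{R}(\theta)=\begin{bmatrix}\cos\theta&-\sin\theta\\ \sin\theta&\cos\theta\end{bmatrix}$, $\mathrm{r}(\theta)=(\cos\theta,\sin\theta)$, $j=\mathrm{R}(\pi/2)$, $\mathsf{J}=\mathrm{diag}(j,0_{3\times3})\in\mathbb{R}^{5\times5}$. Sizes. There are $n_g$ generators, $n_v\ge n_g$ buses (generator $k$ is attached to bus $k$), $n_l=n_v-n_g$, and $n_t$ transmission lines. $E\in\{-1,0,1\}^{n_v\times n_t}$ is the oriented incidence matrix of the network graph (buses are nodes, lines are edges) and $\mathcal{E}=E\otimes I_2$. State and input. $x=(\theta,\omega,i,v,i_T)$, with rotor angles $\theta_k$, rotor speeds $\omega_k\in\mathbb{R}$, machine currents $i_k=(i_{s,k},i_{f,k},i_{d,k},i_{q,k})\in\mathbb{R}^5$ ($i_{s,k}\in\mathbb{R}^2$ stator current; $i_{f,k},i_{d,k},i_{q,k}\in\mathbb{R}$), $k=1,\dots,n_g$; $i_s=(i_{s,1},\dots,i_{s,n_g})\in\mathbb{R}^{2n_g}$ is the vector of stator currents contained in $i$; bus voltages $v_k\in\mathbb{R}^2$, $k=1,\dots,n_v$; line currents $i_{T,k}\in\mathbb{R}^2$, $k=1,\dots,n_t$. The input is $u=(\tau_m,v_f)\in\mathbb{R}^{2n_g}$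 (mechanical torques, excitation voltages). Parameters. $D=\mathrm{diag}(d_k)$, $d_k>0$; $R=\mathrm{diag}(R_1,\dots,R_{n_g})$ with $R_k=\mathrm{diag}(r_{s,k},r_{s,k},r_{f,k},r_{d,k},r_{q,k})$, all entries positive; $C=\mathrm{diag}(c_kI_2)$, $R_T=\mathrm{diag}(r_{T,k}I_2)$, $L_T=\mathrm{diag}(l_{T,k}I_2)$, $c_k,r_{T,k},l_{T,k}>0$. $L(\theta)=\mathrm{diag}(L_1(\theta_1),\dots,L_{n_g}(\theta_{n_g}))$ with $$L_k(\theta_k)=\begin{bmatrix} L_{s,k}(\theta_k) & L_{m,k}(\theta_k) \\ L_{m,k}(\theta_k)^\top & L_{r,k} \end{bmatrix},\quad L_{r,k}=\begin{bmatrix} l_{f,k} & l_{fd,k} & 0 \\ l_{fd,k} & l_{d,k} & 0 \\ 0 & 0 & l_{q,k} \end{bmatrix},$$ $L_{s,k}(\theta_k)=l_{s,k}I_2+\mathrm{R}(2\theta_k)\,\mathrm{diag}(l_{sa,k},-l_{sa,k})$, $L_{m,k}(\theta_k)=\mathrm{R}(\theta_k)\begin{bmatrix} l_{sf,k} & l_{sd,k} & 0 \\ 0 & 0 & -l_{sq,k} \end{bmatrix}$, with $l_{sa,k}\ge0$ and all other inductance constants positive. Torque and induced voltage: $\tau_{e,k}=\tfrac12 i_k^\top(L_k(\theta_k)\mathsf{J}+\mathsf{J}^\top L_k(\theta_k))i_k$ and $v_{\mathrm{ind},k}=\omega_k(L_k(\theta_k)\mathsf{J}^\top+\mathsf{J}L_k(\theta_k))i_k$;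 $\tau_e,v_{\mathrm{ind}}$ are the stacked vectors. Loads: the load current is $i_l(v)=Y_l(v)v$ with $Y_l(v)=\mathrm{diag}(Y_{l,1}(\|v_1\|),\dots,Y_{l,n_v}(\|v_{n_v}\|))$, $Y_{l,k}(\|v_k\|)=I_2g_k(\|v_k\|)+j\,b_k(\|v_k\|)$, $g_k:\mathbb{R}_{\ge0}\to\mathbb{R}_{\ge0}$, $b_k:\mathbb{R}_{\ge0}\to\mathbb{R}$. Selection matrices: $\mathcal{I}_f=I_{n_g}\otimes(0,0,1,0,0)$ (column), $\mathcal{I}_s=I_{n_g}\otimes\begin{bmatrix} I_2 \\ 0_{3\times2} \end{bmatrix}$, $\mathcal{I}_v^\top=[\mathcal{I}_s\;\;0_{5n_g\times2n_l}]$. $J_v=I_{n_v}\otimes j$, $J_T=I_{n_t}\otimes j$, $\mathcal{J}_g=I_{n_g}\otimes\mathsf{J}$. Steady-state set: $\mathcal{S}_{\omega_0}=\{(x,u):\rho(x,u,\omega_0)=0\}$ with $$\rho(x,u,\omega_0)=\begin{bmatrix} \omega_0\mathbf{1}_{n_g}-\omega \\ D \omega+\tau_e-\tau_m \\ (R+\omega_0L(\theta)\mathcal{J}_g)i-\mathcal{I}_v^\top v-\mathcal{I}_fv_f+v_{\mathrm{ind}} \\ \omega_0CJ_vv+\mathcal{I}_vi+\mathcal{E}i_T+i_l(v) \\ (R_T+\omega_0L_TJ_T)i_T-\mathcal{E}^\top v \end{bmatrix}.$$ Network set: $\mathcal{N}_{\omega_0}$ is the set of $(i_s,v,i_T)\in\mathbb{R}^{2n_g}\times\mathbb{R}^{2n_v}\times\mathbb{R}^{2n_t}$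 with $$(Y_l(v)+\omega_0J_vC)v+(i_s,0_{2n_l})+\mathcal{E}i_T=0,\qquad(R_T+\omega_0J_TL_T)i_T-\mathcal{E}^\top v=0.$$
   Formalization: Part (b) is stated only for ω_0 ≠ 0: at ω_0 = 0 a steady state forces v_k = r_{s,k} i_{s,k}, which the network equations do not imply (one unloaded generator bus, no lines, i_s = 0, v ≠ 0); parts (a) and (c) hold for all real ω_0. *)

theory Defs
  imports Complex_Main "Jordan_Normal_Form.Matrix"
begin

text \<open>
  Vectors and matrices have natural-number dimensions, which may be zero. Indices start at 0:
  generators are \<open>k < n\<^sub>g\<close>, buses are \<open>k < n\<^sub>v\<close>, and generator \<open>k\<close> is attached to bus \<open>k\<close>.
\<close>


definition vnorm :: "real vec \<Rightarrow> real" where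
  "vnorm x = sqrt (x \<bullet> x)"

definition kron :: "real mat \<Rightarrow> real mat \<Rightarrow> real mat" (infixl "\<otimes>\<^sub>k" 72) where
  "A \<otimes>\<^sub>k B = mat (dim_row A * dim_row B) (dim_col A * dim_col B)
     (\<lambda>(p, q). A $$ (p div dim_row B, q div dim_col B) * B $$ (p mod dim_row B, q mod dim_col B))"

definition bdiag :: "nat \<Rightarrow> (nat \<Rightarrow> real mat) \<Rightarrow> real mat" where
  "bdiag n A = diag_block_mat (map A [0..<n])"

definition stack :: "nat \<Rightarrow> nat \<Rightarrow> (nat \<Rightarrow> real vec) \<Rightarrow> real vec" where
  "stack m n x = vec (n * m) (\<lambda>p. x (p div m) $ (p mod m))"

definition block :: "nat \<Rightarrow> real vec \<Rightarrow> nat \<Rightarrow> real vec" where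
  "block m x k = vec m (\<lambda>a. x $ (k * m + a))"

definition Rot :: "real \<Rightarrow> real mat" where
  "Rot t = mat_of_rows_list 2 [[cos t, - sin t], [sin t, cos t]]"

definition rot_vec :: "real \<Rightarrow> real vec" where
  "rot_vec t = vec_of_list [cos t, sin t]"

definition jmat :: "real mat" where
  "jmat = Rot (pi / 2)"

definition Jmat :: "real mat" where
  "Jmat = diag_block_mat [jmat, 0\<^sub>m 3 3]"


text \<open>
  Fields indexed by generators: \<open>damp\<close> to \<open>l_q\<close>; by buses: \<open>cap\<close>, \<open>g_load\<close>, \<open>b_load\<close>;
  by lines: \<open>r_T\<close>, \<open>l_T\<close>, \<open>src\<close>, \<open>dst\<close>. Line \<open>e\<close> is oriented from bus \<open>src e\<close> to bus \<open>dst e\<close>;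
  the orientation is arbitrary, and parallel lines are allowed. The load functions live on
  the nonnegative reals and are only ever evaluated at norms.
\<close>

record power_system =
  n_g :: nat
  n_v :: nat
  n_t :: nat
  src :: "nat \<Rightarrow> nat"
  dst :: "nat \<Rightarrow> nat"
  damp :: "nat \<Rightarrow> real"
  r_s :: "nat \<Rightarrow> real"
  r_f :: "nat \<Rightarrow> real"
  r_d :: "nat \<Rightarrow> real"
  r_q :: "nat \<Rightarrow> real"
  l_s :: "nat \<Rightarrow> real"
  l_sa :: "nat \<Rightarrow> real"
  l_sf :: "nat \<Rightarrow> real"
  l_sd :: "nat \<Rightarrow> real"
  l_sq :: "nat \<Rightarrow> real"
  l_f :: "nat \<Rightarrow> real"
  l_fd :: "nat \<Rightarrow> real"
  l_d :: "nat \<Rightarrow> real"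
  l_q :: "nat \<Rightarrow> real"
  cap :: "nat \<Rightarrow> real"
  g_load :: "nat \<Rightarrow> real \<Rightarrow> real"
  b_load :: "nat \<Rightarrow> real \<Rightarrow> real"
  r_T :: "nat \<Rightarrow> real"
  l_T :: "nat \<Rightarrow> real"

definition admissible :: "power_system \<Rightarrow> bool" where
  "admissible P \<longleftrightarrow>
     n_g P \<le> n_v P \<and>
     (\<forall>e<n_t P. src P e < n_v P \<and> dst P e < n_v P \<and> src P e \<noteq> dst P e) \<and>
     (\<forall>k<n_g P. damp P k > 0 \<and>
        r_s P k > 0 \<and> r_f P k > 0 \<and> r_d P k > 0 \<and> r_q P k > 0 \<and>
        l_s P k > 0 \<and> l_sa P k \<ge> 0 \<and> l_sf P k > 0 \<and> l_sd P k > 0 \<and> l_sq P k > 0 \<and>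
        l_f P k > 0 \<and> l_fd P k > 0 \<and> l_d P k > 0 \<and> l_q P k > 0) \<and>
     (\<forall>k<n_v P. cap P k > 0 \<and> (\<forall>s\<ge>0. g_load P k s \<ge> 0)) \<and>
     (\<forall>e<n_t P. r_T P e > 0 \<and> l_T P e > 0)"

definition n_l :: "power_system \<Rightarrow> nat" where
  "n_l P = n_v P - n_g P"


definition Einc :: "power_system \<Rightarrow> real mat" where
  "Einc P = mat (n_v P) (n_t P)
     (\<lambda>(k, e). if k = src P e then 1 else if k = dst P e then -1 else 0)"

definition Ecal :: "power_system \<Rightarrow> real mat" where
  "Ecal P = Einc P \<otimes>\<^sub>k 1\<^sub>m 2"

definition Dmat :: "power_system \<Rightarrow> real mat" where
  "Dmat P = mat_diag (n_g P) (damp P)"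

definition Rk :: "power_system \<Rightarrow> nat \<Rightarrow> real mat" where
  "Rk P k = mat_diag 5 (\<lambda>a. [r_s P k, r_s P k, r_f P k, r_d P k, r_q P k] ! a)"

definition Rmat :: "power_system \<Rightarrow> real mat" where
  "Rmat P = bdiag (n_g P) (Rk P)"

definition Cmat :: "power_system \<Rightarrow> real mat" where
  "Cmat P = bdiag (n_v P) (\<lambda>k. cap P k \<cdot>\<^sub>m 1\<^sub>m 2)"

definition RTmat :: "power_system \<Rightarrow> real mat" where
  "RTmat P = bdiag (n_t P) (\<lambda>e. r_T P e \<cdot>\<^sub>m 1\<^sub>m 2)"

definition LTmat :: "power_system \<Rightarrow> real mat" where
  "LTmat P = bdiag (n_t P) (\<lambda>e. l_T P e \<cdot>\<^sub>m 1\<^sub>m 2)"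

definition Lsk :: "power_system \<Rightarrow> nat \<Rightarrow> real \<Rightarrow> real mat" where
  "Lsk P k t = l_s P k \<cdot>\<^sub>m 1\<^sub>m 2
     + Rot (2 * t) * mat_of_rows_list 2 [[l_sa P k, 0], [0, - l_sa P k]]"

definition Lmk :: "power_system \<Rightarrow> nat \<Rightarrow> real \<Rightarrow> real mat" where
  "Lmk P k t = Rot t * mat_of_rows_list 3 [[l_sf P k, l_sd P k, 0], [0, 0, - l_sq P k]]"

definition Lrk :: "power_system \<Rightarrow> nat \<Rightarrow> real mat" where
  "Lrk P k = mat_of_rows_list 3
     [[l_f P k, l_fd P k, 0], [l_fd P k, l_d P k, 0], [0, 0, l_q P k]]"

definition Lk :: "power_system \<Rightarrow> nat \<Rightarrow> real \<Rightarrow> real mat" where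
  "Lk P k t = four_block_mat (Lsk P k t) (Lmk P k t) (transpose_mat (Lmk P k t)) (Lrk P k)"

definition Lmat :: "power_system \<Rightarrow> real vec \<Rightarrow> real mat" where
  "Lmat P \<theta> = bdiag (n_g P) (\<lambda>k. Lk P k (\<theta> $ k))"

definition If_mat :: "power_system \<Rightarrow> real mat" where
  "If_mat P = 1\<^sub>m (n_g P) \<otimes>\<^sub>k mat_of_cols_list 5 [[0, 0, 1, 0, 0]]"

definition Is_mat :: "power_system \<Rightarrow> real mat" where
  "Is_mat P = 1\<^sub>m (n_g P) \<otimes>\<^sub>k (1\<^sub>m 2 @\<^sub>r 0\<^sub>m 3 2)"

definition Iv_mat :: "power_system \<Rightarrow> real mat" where
  "Iv_mat P = transpose_mat (Is_mat P) @\<^sub>r 0\<^sub>m (2 * n_l P) (5 * n_g P)"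

definition Jv :: "power_system \<Rightarrow> real mat" where
  "Jv P = 1\<^sub>m (n_v P) \<otimes>\<^sub>k jmat"

definition JT :: "power_system \<Rightarrow> real mat" where
  "JT P = 1\<^sub>m (n_t P) \<otimes>\<^sub>k jmat"

definition Jg :: "power_system \<Rightarrow> real mat" where
  "Jg P = 1\<^sub>m (n_g P) \<otimes>\<^sub>k Jmat"


definition Yl :: "power_system \<Rightarrow> real vec \<Rightarrow> real mat" where
  "Yl P v = bdiag (n_v P) (\<lambda>k. g_load P k (vnorm (block 2 v k)) \<cdot>\<^sub>m 1\<^sub>m 2
                               + b_load P k (vnorm (block 2 v k)) \<cdot>\<^sub>m jmat)"

definition il :: "power_system \<Rightarrow> real vec \<Rightarrow> real vec" where
  "il P v = Yl P v *\<^sub>v v"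

definition tau_ek :: "power_system \<Rightarrow> nat \<Rightarrow> real vec \<Rightarrow> real vec \<Rightarrow> real" where
  "tau_ek P k \<theta> i = 1 / 2 *
     (block 5 i k \<bullet>
       ((Lk P k (\<theta> $ k) * Jmat + transpose_mat Jmat * Lk P k (\<theta> $ k)) *\<^sub>v block 5 i k))"

definition tau_e :: "power_system \<Rightarrow> real vec \<Rightarrow> real vec \<Rightarrow> real vec" where
  "tau_e P \<theta> i = vec (n_g P) (\<lambda>k. tau_ek P k \<theta> i)"

definition v_indk :: "power_system \<Rightarrow> nat \<Rightarrow> real vec \<Rightarrow> real vec \<Rightarrow> real vec \<Rightarrow> real vec" where
  "v_indk P k \<theta> \<omega> i = \<omega> $ k \<cdot>\<^sub>v
     ((Lk P k (\<theta> $ k) * transpose_mat Jmat + Jmat * Lk P k (\<theta> $ k)) *\<^sub>v block 5 i k)"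

definition v_ind :: "power_system \<Rightarrow> real vec \<Rightarrow> real vec \<Rightarrow> real vec \<Rightarrow> real vec" where
  "v_ind P \<theta> \<omega> i = stack 5 (n_g P) (\<lambda>k. v_indk P k \<theta> \<omega> i)"


definition is_k :: "real vec \<Rightarrow> nat \<Rightarrow> real vec" where
  "is_k i k = vec_first (block 5 i k) 2"

definition if_k :: "real vec \<Rightarrow> nat \<Rightarrow> real" where
  "if_k i k = block 5 i k $ 2"

definition id_k :: "real vec \<Rightarrow> nat \<Rightarrow> real" where
  "id_k i k = block 5 i k $ 3"

definition iq_k :: "real vec \<Rightarrow> nat \<Rightarrow> real" where
  "iq_k i k = block 5 i k $ 4"

definition stator_currents :: "power_system \<Rightarrow> real vec \<Rightarrow> real vec" where
  "stator_currents P i = stack 2 (n_g P) (is_k i)"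


type_synonym state = "real vec \<times> real vec \<times> real vec \<times> real vec \<times> real vec"
type_synonym inp = "real vec \<times> real vec"

definition states :: "power_system \<Rightarrow> state set" where
  "states P = carrier_vec (n_g P) \<times> carrier_vec (n_g P) \<times> carrier_vec (5 * n_g P)
              \<times> carrier_vec (2 * n_v P) \<times> carrier_vec (2 * n_t P)"

definition inputs :: "power_system \<Rightarrow> inp set" where
  "inputs P = carrier_vec (n_g P) \<times> carrier_vec (n_g P)"

definition rho :: "power_system \<Rightarrow> state \<Rightarrow> inp \<Rightarrow> real \<Rightarrow> real vec" where
  "rho P x u \<omega>\<^sub>0 = (case x of (\<theta>, \<omega>, i, v, i\<^sub>T) \<Rightarrow> case u of (\<tau>\<^sub>m, v\<^sub>f) \<Rightarrow>
       (\<omega>\<^sub>0 \<cdot>\<^sub>v vec (n_g P) (\<lambda>_. 1) - \<omega>)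
    @\<^sub>v (Dmat P *\<^sub>v \<omega> + tau_e P \<theta> i - \<tau>\<^sub>m)
    @\<^sub>v ((Rmat P + \<omega>\<^sub>0 \<cdot>\<^sub>m (Lmat P \<theta> * Jg P)) *\<^sub>v i
          - transpose_mat (Iv_mat P) *\<^sub>v v - If_mat P *\<^sub>v v\<^sub>f + v_ind P \<theta> \<omega> i)
    @\<^sub>v ((\<omega>\<^sub>0 \<cdot>\<^sub>m (Cmat P * Jv P)) *\<^sub>v v + Iv_mat P *\<^sub>v i + Ecal P *\<^sub>v i\<^sub>T + il P v)
    @\<^sub>v ((RTmat P + \<omega>\<^sub>0 \<cdot>\<^sub>m (LTmat P * JT P)) *\<^sub>v i\<^sub>T - transpose_mat (Ecal P) *\<^sub>v v))"

definition steady_states :: "power_system \<Rightarrow> real \<Rightarrow> (state \<times> inp) set" where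
  "steady_states P \<omega>\<^sub>0 = {(x, u). x \<in> states P \<and> u \<in> inputs P \<and>
     rho P x u \<omega>\<^sub>0 = 0\<^sub>v (n_g P + n_g P + 5 * n_g P + 2 * n_v P + 2 * n_t P)}"

definition network_space :: "power_system \<Rightarrow> (real vec \<times> real vec \<times> real vec) set" where
  "network_space P =
     carrier_vec (2 * n_g P) \<times> carrier_vec (2 * n_v P) \<times> carrier_vec (2 * n_t P)"

definition network_set :: "power_system \<Rightarrow> real \<Rightarrow> (real vec \<times> real vec \<times> real vec) set" where
  "network_set P \<omega>\<^sub>0 = {(i\<^sub>s, v, i\<^sub>T). (i\<^sub>s, v, i\<^sub>T) \<in> network_space P \<and>
     (Yl P v + \<omega>\<^sub>0 \<cdot>\<^sub>m (Jv P * Cmat P)) *\<^sub>v v + (i\<^sub>s @\<^sub>v 0\<^sub>v (2 * n_l P)) + Ecal P *\<^sub>v i\<^sub>T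
       = 0\<^sub>v (2 * n_v P) \<and>
     (RTmat P + \<omega>\<^sub>0 \<cdot>\<^sub>m (JT P * LTmat P)) *\<^sub>v i\<^sub>T - transpose_mat (Ecal P) *\<^sub>v v = 0\<^sub>v (2 * n_t P)}"

definition nu :: "power_system \<Rightarrow> real \<Rightarrow> nat \<Rightarrow> real \<Rightarrow> real vec \<Rightarrow> real vec \<Rightarrow> real vec" where
  "nu P \<omega>\<^sub>0 k t v i\<^sub>s =
     block 2 v k - (r_s P k \<cdot>\<^sub>m 1\<^sub>m 2 + \<omega>\<^sub>0 \<cdot>\<^sub>m (jmat * Lsk P k t)) *\<^sub>v block 2 i\<^sub>s k"

end

theory Submission
  imports Defs
begin

text \<open>
  Since \<open>\<omega> = \<omega>\<^sub>0\<close> in steady state and \<open>J\<close> is skew, the induced voltage cancels \<open>\<omega>\<^sub>0 L J\<close> in the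
  machine equation, leaving \<open>R i + \<omega>\<^sub>0 J L i\<close>. The damper rows then force \<open>i\<^sub>d = i\<^sub>q = 0\<close>, the
  field row gives \<open>v\<^sub>f = r\<^sub>f i\<^sub>f\<close>, and the stator rows read \<open>\<nu>(\<theta>) = \<omega>\<^sub>0 l\<^sub>s\<^sub>f i\<^sub>f j r(\<theta>)\<close>. As
  \<open>j r(\<theta>)\<close> is a unit vector, this fixes \<open>\<omega>\<^sub>0 l\<^sub>s\<^sub>f i\<^sub>f\<close> up to the sign \<open>\<sigma>\<close>. For
  \<open>\<omega>\<^sub>0 \<noteq> 0\<close> it is solvable precisely when \<open>r(\<theta>) \<bullet> \<nu>(\<theta>) = 0\<close>; this condition reduces to the orthogonality of \<open>r(\<theta>)\<close> to
  a fixed vector, so a suitable \<open>\<theta>\<close> always exists.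
\<close>

subsection \<open>Block vectors and block-diagonal matrices\<close>

lemma dim_block [simp]: "dim_vec (block m x k) = m"
  by (simp add: block_def)

lemma block_carrier [simp]: "block m x k \<in> carrier_vec m"
  by (rule carrier_vecI) simp

lemma index_block [simp]: "a < m \<Longrightarrow> block m x k $ a = x $ (k * m + a)"
  by (simp add: block_def)

lemma block_index_less:
  fixes k n :: nat
  assumes "k < n" "a < m"
  shows "k * m + a < m * n"
proof -
  have "k * m + a < Suc k * m" using assms by simp
  also have "\<dots> \<le> n * m" using assms by (intro mult_right_mono) auto
  finally show ?thesis by (simp add: mult.commute)
qed

lemma block_eqI:
  assumes "dim_vec x = m * n" "dim_vec y = m * n" "\<And>k. k < n \<Longrightarrow> block m x k = block m y k"
  shows "x = y"
proof (rule eq_vecI)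
  fix p assume "p < dim_vec y"
  then have p: "p < m * n" using assms by simp
  \<comment> \<open>A valid index \<open>p\<close> exists, so blocks are nonempty and
    \<open>p mod m\<close> is a legal position inside one.\<close>
  then have m: "m > 0" by (cases m) auto
  have "p div m < n" using p by (simp add: less_mult_imp_div_less mult.commute)
  from arg_cong[OF assms(3)[OF this], of "\<lambda>z. z $ (p mod m)"] m
  show "x $ p = y $ p" by simp
qed (simp add: assms)

lemma block_zero:
  assumes "k < n"
  shows "block m (0\<^sub>v (m * n)) k = 0\<^sub>v m"
  using block_index_less[OF assms] by (intro eq_vecI) auto

lemma zero_vec_iff_blocks:
  assumes "dim_vec x = m * n"
  shows "x = 0\<^sub>v (m * n) \<longleftrightarrow> (\<forall>k<n. block m x k = 0\<^sub>v m)"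
  using block_eqI[of x m n "0\<^sub>v (m * n)"] assms by (auto simp: block_zero)

text \<open>A vector sum takes its dimension from the second operand, which explains the form of the
  hypothesis.\<close>

lemma block_add:
  assumes "k < n" "dim_vec y = m * n"
  shows "block m (x + y) k = block m x k + block m y k"
  using block_index_less[OF assms(1), of _ m] assms(2) by (intro eq_vecI) auto

lemma block_minus:
  assumes "k < n" "dim_vec y = m * n"
  shows "block m (x - y) k = block m x k - block m y k"
  using block_index_less[OF assms(1), of _ m] assms(2) by (intro eq_vecI) auto

lemma block_smult:
  assumes "k < n" "dim_vec x = m * n"
  shows "block m (c \<cdot>\<^sub>v x) k = c \<cdot>\<^sub>v block m x k"
  using block_index_less[OF assms(1), of _ m] assms(2) by (intro eq_vecI) auto

lemma block_stack:
  assumes "k < n" "dim_vec (x k) = m"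
  shows "block m (stack m n x) k = x k"
  using block_index_less[OF assms(1), of _ m] assms(2)
  by (intro eq_vecI) (auto simp: stack_def mult.commute)

lemma dim_stack [simp]: "dim_vec (stack m n x) = m * n"
  by (simp add: stack_def mult.commute)

section \<open>Block-diagonal matrices with equal block sizes, and Kronecker products with an
  identity\<close>

lemma diag_block_mat_uniform:
  assumes "\<forall>A\<in>set As. A \<in> carrier_mat r c"
  shows "diag_block_mat As \<in> carrier_mat (r * length As) (c * length As) \<and>
    (\<forall>p<r * length As. \<forall>q<c * length As. diag_block_mat As $$ (p, q) =
       (if p div r = q div c then (As ! (p div r)) $$ (p mod r, q mod c) else 0))"
  using assms
\<comment> \<open>Dimensions and entries share one induction: locating an entry past the first block
  requires the dimensions of the tail.\<close>
proof (induction As)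
  case Nil
  then show ?case by simp
next
  case (Cons A As)
  have A: "A \<in> carrier_mat r c" using Cons.prems by simp
  have IH: "diag_block_mat As \<in> carrier_mat (r * length As) (c * length As)"
    "\<And>p q. p < r * length As \<Longrightarrow> q < c * length As \<Longrightarrow> diag_block_mat As $$ (p, q) =
       (if p div r = q div c then (As ! (p div r)) $$ (p mod r, q mod c) else 0)"
    using Cons by auto
  have "diag_block_mat (A # As) $$ (p, q) =
      (if p div r = q div c then ((A # As) ! (p div r)) $$ (p mod r, q mod c) else 0)"
    if p: "p < r * length (A # As)" and q: "q < c * length (A # As)" for p q
  proof -
    \<comment> \<open>Valid indices force positive block sizes. Past the first block, subtracting
      \<open>r\<close> or \<open>c\<close> then lowers the quotient by one and keeps the
      remainder.\<close>
    have rc: "0 < r" "0 < c" using p q by (auto intro: gr0I)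
    have less: "p - r < r * length As" if "\<not> p < r" using p rc that by auto
    have less': "q - c < c * length As" if "\<not> q < c" using q rc that by auto
    show ?thesis
      using A IH(1) p q rc less less'
      by (auto simp: Let_def IH(2) le_div_geq le_mod_geq not_less)
  qed
  then show ?case using A IH(1) by (auto simp: Let_def)
qed

lemma bdiag_carrier:
  assumes "\<And>k. k < n \<Longrightarrow> A k \<in> carrier_mat r c"
  shows "bdiag n A \<in> carrier_mat (r * n) (c * n)"
  using diag_block_mat_uniform[of "map A [0..<n]" r c] assms by (auto simp: bdiag_def)

lemma index_bdiag:
  assumes "\<And>k. k < n \<Longrightarrow> A k \<in> carrier_mat r c" "p < r * n" "q < c * n"
  shows "bdiag n A $$ (p, q) = (if p div r = q div c then A (p div r) $$ (p mod r, q mod c) else 0)"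
proof -
  have "p div r < n" using assms(2) by (simp add: less_mult_imp_div_less mult.commute)
  then show ?thesis
    using diag_block_mat_uniform[of "map A [0..<n]" r c] assms by (auto simp: bdiag_def)
qed

text \<open>The row sum is cut into runs of \<open>c\<close> consecutive columns, one per block; in
  a row of block \<open>k\<close> only run \<open>k\<close> meets nonzero entries.\<close>

lemma block_bdiag_mult_vec:
  assumes A: "\<And>k. k < n \<Longrightarrow> A k \<in> carrier_mat r c" and x: "dim_vec x = c * n" and k: "k < n"
  shows "block r (bdiag n A *\<^sub>v x) k = A k *\<^sub>v block c x k"
proof (rule eq_vecI)
  fix a assume "a < dim_vec (A k *\<^sub>v block c x k)"
  then have a: "a < r" using A[OF k] by simp
  have p: "k * r + a < r * n" using block_index_less[OF k a] .
  let ?f = "\<lambda>q. bdiag n A $$ (k * r + a, q) * x $ q"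
  have "block r (bdiag n A *\<^sub>v x) k $ a = sum ?f {0..<c * n}"
    using bdiag_carrier[of n A r c] A p a x
    by (auto simp: scalar_prod_def intro!: sum.cong)
  also have "\<dots> = sum ?f {..<n * c}"
    by (simp add: atLeast0LessThan mult.commute)
  also have "\<dots> = (\<Sum>l<n. sum ?f {l * c..<l * c + c})"
    by (rule sum.nat_group[symmetric])
  also have "\<dots> = (\<Sum>l<n. if l = k then \<Sum>b<c. A k $$ (a, b) * x $ (k * c + b) else 0)"
  proof (rule sum.cong)
    fix l assume "l \<in> {..<n}"
    then have l: "l < n" by simp
    have "sum ?f {l * c..<l * c + c} = (\<Sum>b<c. ?f (l * c + b))"
      using sum.shift_bounds_nat_ivl[of ?f 0 "l * c" c] by (simp add: add.commute atLeast0LessThan)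
    also have "\<dots> = (\<Sum>b<c. if l = k then A k $$ (a, b) * x $ (k * c + b) else 0)"
      using a p block_index_less[OF l, of _ c]
      by (intro sum.cong) (auto simp: index_bdiag[OF A])
    finally show "sum ?f {l * c..<l * c + c} =
      (if l = k then \<Sum>b<c. A k $$ (a, b) * x $ (k * c + b) else 0)" by simp
  qed simp
  also have "\<dots> = (A k *\<^sub>v block c x k) $ a"
    using k a A[OF k] by (simp add: scalar_prod_def atLeast0LessThan)
  finally show "block r (bdiag n A *\<^sub>v x) k $ a = (A k *\<^sub>v block c x k) $ a" .
qed (use A[OF k] in simp)

text \<open>Brings the selection matrices and the various J matrices under the block product rule
  for \<open>bdiag\<close>.\<close>

lemma one_kron_eq_bdiag:
  assumes B: "B \<in> carrier_mat r c"
  shows "1\<^sub>m n \<otimes>\<^sub>k B = bdiag n (\<lambda>_. B)"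
proof (rule eq_matI)
  have bc: "bdiag n (\<lambda>_. B) \<in> carrier_mat (r * n) (c * n)"
    using B by (rule bdiag_carrier)
  show "dim_row (1\<^sub>m n \<otimes>\<^sub>k B) = dim_row (bdiag n (\<lambda>_. B))"
    and "dim_col (1\<^sub>m n \<otimes>\<^sub>k B) = dim_col (bdiag n (\<lambda>_. B))"
    using B bc by (simp_all add: kron_def mult.commute)
  fix p q assume "p < dim_row (bdiag n (\<lambda>_. B))" "q < dim_col (bdiag n (\<lambda>_. B))"
  then have pq: "p < r * n" "q < c * n" using bc by auto
  then have "p div r < n" "q div c < n"
    by (simp_all add: less_mult_imp_div_less mult.commute)
  then show "(1\<^sub>m n \<otimes>\<^sub>k B) $$ (p, q) = bdiag n (\<lambda>_. B) $$ (p, q)"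
    using B pq by (subst index_bdiag[OF B]) (auto simp: kron_def mult.commute)
qed

lemma one_kron_carrier:
  assumes "B \<in> carrier_mat r c"
  shows "1\<^sub>m n \<otimes>\<^sub>k B \<in> carrier_mat (r * n) (c * n)"
  using assms by (auto simp: kron_def)

lemma block_one_kron_mult_vec:
  assumes "B \<in> carrier_mat r c" "dim_vec x = c * n" "k < n"
  shows "block r ((1\<^sub>m n \<otimes>\<^sub>k B) *\<^sub>v x) k = B *\<^sub>v block c x k"
  using assms by (subst one_kron_eq_bdiag[OF assms(1)], intro block_bdiag_mult_vec) auto

lemma transpose_one_kron:
  assumes B: "B \<in> carrier_mat r c"
  shows "transpose_mat (1\<^sub>m n \<otimes>\<^sub>k B) = 1\<^sub>m n \<otimes>\<^sub>k transpose_mat B"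
proof (rule eq_matI)
  fix p q assume "p < dim_row (1\<^sub>m n \<otimes>\<^sub>k transpose_mat B)" "q < dim_col (1\<^sub>m n \<otimes>\<^sub>k transpose_mat B)"
  then have pq: "p < n * c" "q < n * r" using B by (auto simp: kron_def)
  then have "0 < c" "0 < r" by (auto intro: gr0I)
  moreover have "p div c < n" "q div r < n"
    using pq by (simp_all add: less_mult_imp_div_less)
  ultimately show "transpose_mat (1\<^sub>m n \<otimes>\<^sub>k B) $$ (p, q) = (1\<^sub>m n \<otimes>\<^sub>k transpose_mat B) $$ (p, q)"
    using B pq by (auto simp: kron_def)
qed (use B in \<open>auto simp: kron_def\<close>)

text \<open>Zero padding occurs at two scales: in the stator selector of one machine and in
  \<open>Iv_mat\<close>, where load buses receive no machine current. This rule and its transposed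
  version serve both.\<close>

lemma mult_vec_append_rows_zero:
  fixes A :: "real mat"
  assumes "A \<in> carrier_mat r c" "x \<in> carrier_vec c"
  shows "(A @\<^sub>r 0\<^sub>m s c) *\<^sub>v x = (A *\<^sub>v x) @\<^sub>v 0\<^sub>v s"
proof -
  have "0\<^sub>m s c *\<^sub>v x = 0\<^sub>v s"
    using assms(2) by (intro eq_vecI) (auto simp: scalar_prod_def)
  then show ?thesis by (simp add: mat_mult_append[OF assms(1) zero_carrier_mat assms(2)])
qed

lemma transpose_append_rows_zero_mult_vec:
  fixes A :: "real mat"
  assumes A: "A \<in> carrier_mat r c" and x: "dim_vec x = r + s"
  shows "transpose_mat (A @\<^sub>r 0\<^sub>m s c) *\<^sub>v x = transpose_mat A *\<^sub>v vec_first x r"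
proof (rule eq_vecI)
  fix p assume "p < dim_vec (transpose_mat A *\<^sub>v vec_first x r)"
  then have p: "p < c" using A by simp
  have "(transpose_mat (A @\<^sub>r 0\<^sub>m s c) *\<^sub>v x) $ p
      = (\<Sum>q = 0..<r + s. (A @\<^sub>r 0\<^sub>m s c) $$ (q, p) * x $ q)"
    using A x p by (auto simp: append_rows_def scalar_prod_def intro!: sum.cong)
  also have "\<dots> = (\<Sum>q = 0..<r. A $$ (q, p) * x $ q)"
    \<comment> \<open>Positions from \<open>r\<close> on belong to the zero rows and drop out of the
      sum.\<close>
    using A p by (intro sum.mono_neutral_cong_right) (auto simp: append_rows_def)
  also have "\<dots> = (transpose_mat A *\<^sub>v vec_first x r) $ p"
    using A p by (auto simp: scalar_prod_def vec_first_def)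
  finally show "(transpose_mat (A @\<^sub>r 0\<^sub>m s c) *\<^sub>v x) $ p = (transpose_mat A *\<^sub>v vec_first x r) $ p" .
qed (use A in \<open>simp add: append_rows_def\<close>)

subsection \<open>Planar rotations and machine matrices\<close>

lemma append_vec_eq_zero_iff:
  assumes "dim_vec x = m" "dim_vec y = n"
  shows "x @\<^sub>v y = 0\<^sub>v (m + n) \<longleftrightarrow> x = 0\<^sub>v m \<and> y = 0\<^sub>v n"
proof -
  have "0\<^sub>v (m + n) = 0\<^sub>v m @\<^sub>v 0\<^sub>v n" by (intro eq_vecI) auto
  then show ?thesis using append_vec_eq[OF carrier_vecI zero_carrier_vec, of x m] assms by metis
qed

text \<open>The shape A + a B C is shared by the machine, bus and line equations and by
  \<open>nu\<close>.\<close>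

lemma add_smult_mult_mult_vec:
  fixes A B C :: "real mat"
  assumes "A \<in> carrier_mat r c" "B \<in> carrier_mat r s" "C \<in> carrier_mat s c" "x \<in> carrier_vec c"
  shows "(A + a \<cdot>\<^sub>m (B * C)) *\<^sub>v x = A *\<^sub>v x + a \<cdot>\<^sub>v (B *\<^sub>v (C *\<^sub>v x))"
proof -
  have "a \<cdot>\<^sub>m (B * C) *\<^sub>v x = a \<cdot>\<^sub>v (B * C *\<^sub>v x)"
    using assms by (intro eq_vecI) (auto simp del: assoc_mult_mat_vec)
  then show ?thesis using assms by (simp add: add_mult_distrib_mat_vec[of _ r c])
qed

lemma sum_nat_2: "sum f {0..<2::nat} = f 0 + f (Suc 0)"
  by (simp add: numeral_2_eq_2)

lemma sum_nat_5: "sum f {0..<5::nat} = f 0 + f (Suc 0) + f 2 + f 3 + f 4"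
  by (simp add: numeral_eq_Suc)

lemma all_less_2: "(\<forall>a<2::nat. Q a) \<longleftrightarrow> Q 0 \<and> Q (Suc 0)"
  by (auto simp: less_2_cases_iff)

lemma all_less_5: "(\<forall>a<5::nat. Q a) \<longleftrightarrow> Q 0 \<and> Q (Suc 0) \<and> Q 2 \<and> Q 3 \<and> Q 4"
proof -
  have "a < 5 \<longleftrightarrow> a \<in> {0, Suc 0, 2, 3, 4}" for a :: nat by auto
  then show ?thesis by auto
qed

lemma vec2_eq_iff:
  assumes "dim_vec x = 2" "dim_vec y = 2"
  shows "x = y \<longleftrightarrow> x $ 0 = y $ 0 \<and> x $ Suc 0 = y $ Suc 0"
  using assms by (simp add: vec_eq_iff all_less_2)

lemma vec5_eq_iff:
  assumes "dim_vec x = 5" "dim_vec y = 5"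
  shows "x = y \<longleftrightarrow> x $ 0 = y $ 0 \<and> x $ Suc 0 = y $ Suc 0 \<and> x $ 2 = y $ 2 \<and> x $ 3 = y $ 3 \<and> x $ 4 = y $ 4"
  using assms by (simp add: vec_eq_iff all_less_5)

lemma index_mult_vec_2:
  assumes "A \<in> carrier_mat r 2" "dim_vec x = 2" "a < r"
  shows "(A *\<^sub>v x) $ a = A $$ (a, 0) * x $ 0 + A $$ (a, Suc 0) * x $ Suc 0"
  using assms by (simp add: scalar_prod_def sum_nat_2)

lemma index_mult_vec_5:
  assumes "A \<in> carrier_mat r 5" "dim_vec x = 5" "a < r"
  shows "(A *\<^sub>v x) $ a = A $$ (a, 0) * x $ 0 + A $$ (a, Suc 0) * x $ Suc 0 + A $$ (a, 2) * x $ 2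
    + A $$ (a, 3) * x $ 3 + A $$ (a, 4) * x $ 4"
  using assms by (simp add: scalar_prod_def sum_nat_5)

lemma vnorm_smult: "vnorm (c \<cdot>\<^sub>v x) = \<bar>c\<bar> * vnorm x"
proof -
  have "(c \<cdot>\<^sub>v x) \<bullet> (c \<cdot>\<^sub>v x) = c\<^sup>2 * (x \<bullet> x)"
    by (simp add: scalar_prod_def sum_distrib_left power2_eq_square mult_ac)
  then show ?thesis by (simp add: vnorm_def real_sqrt_mult)
qed

section \<open>Rotations, the skew matrix J, and the inductance and resistance matrices\<close>

lemma Rot_carrier [simp]: "Rot t \<in> carrier_mat 2 2"
  by (rule carrier_matI) (simp_all add: Rot_def mat_of_rows_list_def)

lemma index_Rot:
  "Rot t $$ (0, 0) = cos t" "Rot t $$ (0, Suc 0) = - sin t"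
  "Rot t $$ (Suc 0, 0) = sin t" "Rot t $$ (Suc 0, Suc 0) = cos t"
  by (simp_all add: Rot_def mat_of_rows_list_def)

lemma jmat_carrier [simp]: "jmat \<in> carrier_mat 2 2"
  by (simp add: jmat_def)

lemma dim_jmat [simp]: "dim_row jmat = 2" "dim_col jmat = 2"
  using carrier_matD[OF jmat_carrier] by auto

lemma index_jmat_mult_vec:
  assumes "dim_vec x = 2"
  shows "(jmat *\<^sub>v x) $ 0 = - x $ Suc 0" "(jmat *\<^sub>v x) $ Suc 0 = x $ 0"
  using index_mult_vec_2[OF jmat_carrier assms] by (simp_all add: jmat_def index_Rot)

lemma dim_rot_vec [simp]: "dim_vec (rot_vec t) = 2"
  by (simp add: rot_vec_def)

lemma index_rot_vec: "rot_vec t $ 0 = cos t" "rot_vec t $ Suc 0 = sin t"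
  by (simp_all add: rot_vec_def)

lemma vnorm_jmat_rot_vec: "vnorm (jmat *\<^sub>v rot_vec t) = 1"
  by (simp add: vnorm_def scalar_prod_def[of _ "jmat *\<^sub>v rot_vec t"] sum_nat_2 index_jmat_mult_vec
      index_rot_vec del: index_mult_mat_vec vec_of_list_Cons flip: power2_eq_square)

lemma Jmat_carrier [simp]: "Jmat \<in> carrier_mat 5 5"
  by (auto simp: Jmat_def Let_def)

lemma dim_Jmat [simp]: "dim_row Jmat = 5" "dim_col Jmat = 5"
  using carrier_matD[OF Jmat_carrier] by auto

lemma Jmat_mult_vec:
  assumes "dim_vec x = 5"
  shows "Jmat *\<^sub>v x = vec_of_list [- x $ Suc 0, x $ 0, 0, 0, 0]"
  using assms index_Rot(1,2)[of "pi / 2"] index_Rot(3,4)[of "pi / 2"]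
  by (simp add: vec5_eq_iff vec_of_list_index index_mult_vec_5[OF Jmat_carrier] del: index_mult_mat_vec vec_of_list_Cons)
    (simp add: Jmat_def Let_def jmat_def carrier_matD[OF Rot_carrier])

lemma transpose_Jmat: "transpose_mat Jmat = - Jmat"
proof -
  have "\<forall>p<5. \<forall>q<5. transpose_mat Jmat $$ (p, q) = (- Jmat) $$ (p, q)"
    \<comment> \<open>At a quarter turn the cosine entries vanish and the sines are 1 and -1, so
      \<open>jmat\<close> is skew; the other entries of \<open>Jmat\<close> are zero.\<close>
    using index_Rot(1,2)[of "pi / 2"] index_Rot(3,4)[of "pi / 2"]
    by (simp add: all_less_5)
      (simp add: Jmat_def Let_def jmat_def carrier_matD[OF Rot_carrier])
  note * = this
  show ?thesis
  proof (rule eq_matI)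
    fix p q assume "p < dim_row (- Jmat)" "q < dim_col (- Jmat)"
    then have "p < 5" "q < 5" by simp_all
    with * show "transpose_mat Jmat $$ (p, q) = (- Jmat) $$ (p, q)" by blast
  qed simp_all
qed

lemma Lsk_carrier [simp]: "Lsk P k t \<in> carrier_mat 2 2"
  unfolding Lsk_def
  by (intro add_carrier_mat mult_carrier_mat[OF Rot_carrier] carrier_matI)
    (simp_all add: mat_of_rows_list_def)

lemma index_Lsk:
  "Lsk P k t $$ (0, 0) = l_s P k + l_sa P k * cos (2 * t)" "Lsk P k t $$ (0, Suc 0) = l_sa P k * sin (2 * t)"
  "Lsk P k t $$ (Suc 0, 0) = l_sa P k * sin (2 * t)" "Lsk P k t $$ (Suc 0, Suc 0) = l_s P k - l_sa P k * cos (2 * t)"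
  using index_Rot[of "2 * t"]
  by (simp_all add: Lsk_def mat_of_rows_list_def scalar_prod_def sum_nat_2
      carrier_matD[OF Rot_carrier])

text \<open>Only the field column is evaluated: the damper columns multiply currents that vanish in
  steady state.\<close>

lemma index_Lmk:
  "Lmk P k t $$ (0, 0) = l_sf P k * cos t" "Lmk P k t $$ (Suc 0, 0) = l_sf P k * sin t"
  using index_Rot[of t]
  by (simp_all add: Lmk_def mat_of_rows_list_def scalar_prod_def sum_nat_2
      carrier_matD[OF Rot_carrier])

lemma Lk_carrier [simp]: "Lk P k t \<in> carrier_mat 5 5"
proof -
  have "Lrk P k \<in> carrier_mat 3 3" by (intro carrier_matI) (simp_all add: Lrk_def mat_of_rows_list_def)
  with four_block_carrier_mat[OF Lsk_carrier this] show ?thesis by (simp add: Lk_def)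
qed

lemma Rk_carrier [simp]: "Rk P k \<in> carrier_mat 5 5"
  by (simp add: Rk_def mat_diag_def)

lemma Rk_mult_vec:
  assumes "dim_vec x = 5"
  shows "Rk P k *\<^sub>v x = vec_of_list [r_s P k * x $ 0, r_s P k * x $ Suc 0, r_f P k * x $ 2, r_d P k * x $ 3, r_q P k * x $ 4]"
  using assms by (simp add: vec5_eq_iff vec_of_list_index index_mult_vec_5[OF Rk_carrier] carrier_matD[OF Rk_carrier]
    del: index_mult_mat_vec vec_of_list_Cons) (simp add: Rk_def mat_diag_def)

lemma dim_nu [simp]: "dim_vec (nu P \<omega>\<^sub>0 k t v i\<^sub>s) = 2"
  by (simp add: nu_def)

text \<open>The saliency part, which alone depends on the angle, is kept apart from the constant
  part \<open>l_s\<close>.\<close>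

lemma index_Lsk_mult_vec:
  assumes "dim_vec x = 2"
  shows "(Lsk P k t *\<^sub>v x) $ 0 = l_s P k * x $ 0 + l_sa P k * (cos (2 * t) * x $ 0 + sin (2 * t) * x $ Suc 0)"
    and "(Lsk P k t *\<^sub>v x) $ Suc 0 = l_s P k * x $ Suc 0 + l_sa P k * (sin (2 * t) * x $ 0 - cos (2 * t) * x $ Suc 0)"
  using index_mult_vec_2[OF Lsk_carrier assms] by (simp_all add: index_Lsk algebra_simps)

lemma nu_eq:
  "nu P \<omega>\<^sub>0 k t v i\<^sub>s = block 2 v k - (r_s P k \<cdot>\<^sub>v block 2 i\<^sub>s k
     + \<omega>\<^sub>0 \<cdot>\<^sub>v (jmat *\<^sub>v (Lsk P k t *\<^sub>v block 2 i\<^sub>s k)))"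
proof -
  have "r_s P k \<cdot>\<^sub>m 1\<^sub>m 2 *\<^sub>v block 2 i\<^sub>s k = r_s P k \<cdot>\<^sub>v (1\<^sub>m 2 *\<^sub>v block 2 i\<^sub>s k)"
    by (intro eq_vecI) auto
  then show ?thesis
    by (simp add: nu_def add_smult_mult_mult_vec[where r = 2 and c = 2 and s = 2])
qed

lemma index_nu:
  "nu P \<omega>\<^sub>0 k t v i\<^sub>s $ 0 = block 2 v k $ 0 - r_s P k * block 2 i\<^sub>s k $ 0 + \<omega>\<^sub>0 * (Lsk P k t *\<^sub>v block 2 i\<^sub>s k) $ Suc 0"
  "nu P \<omega>\<^sub>0 k t v i\<^sub>s $ Suc 0 = block 2 v k $ Suc 0 - r_s P k * block 2 i\<^sub>s k $ Suc 0 - \<omega>\<^sub>0 * (Lsk P k t *\<^sub>v block 2 i\<^sub>s k) $ 0"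
  using index_jmat_mult_vec[of "Lsk P k t *\<^sub>v block 2 i\<^sub>s k"] carrier_matD[OF Lsk_carrier]
  by (simp_all add: nu_eq del: index_mult_mat_vec vec_of_list_Cons)

subsection \<open>The machine equation\<close>

text \<open>Without damper currents, a stator flux consists of the stator contribution and that of
  the field winding. Stator rows suffice because J discards the rotor rows.\<close>

lemma index_Lk_mult_vec:
  assumes x: "dim_vec x = 5" "x $ 3 = 0" "x $ 4 = 0" and a: "a < 2"
  shows "(Lk P k t *\<^sub>v x) $ a = (Lsk P k t *\<^sub>v vec_first x 2) $ a + Lmk P k t $$ (a, 0) * x $ 2"
proof -
  have "Lrk P k \<in> carrier_mat 3 3"
    by (intro carrier_matI) (simp_all add: Lrk_def mat_of_rows_list_def)
  then have "Lk P k t $$ (a, b) = (if b < 2 then Lsk P k t $$ (a, b) else Lmk P k t $$ (a, b - 2))"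
    if "b < 5" for b
    using that a carrier_matD[OF Lsk_carrier, of P k t] by (auto simp: Lk_def)
  then show ?thesis
    using x a
    by (simp add: index_mult_vec_5[OF Lk_carrier] index_mult_vec_2[OF Lsk_carrier] vec_first_def
        del: index_mult_mat_vec)
qed

text \<open>As J is skew, the part of the induced voltage with L J^T is the negative of the first
  summand. This requires the same speed \<open>w\<close> in both terms.\<close>

lemma induced_voltage_cancel:
  assumes x: "dim_vec x = 5"
  shows "w \<cdot>\<^sub>v (Lk P k t *\<^sub>v (Jmat *\<^sub>v x))
      + w \<cdot>\<^sub>v ((Lk P k t * transpose_mat Jmat + Jmat * Lk P k t) *\<^sub>v x)
    = w \<cdot>\<^sub>v (Jmat *\<^sub>v (Lk P k t *\<^sub>v x))"
proof -
  have x': "x \<in> carrier_vec 5" using x by (rule carrier_vecI)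
  have "Lk P k t * transpose_mat Jmat *\<^sub>v x = Lk P k t *\<^sub>v (- Jmat *\<^sub>v x)"
    unfolding transpose_Jmat by (rule assoc_mult_mat_vec[of _ 5 5 _ 5]) (use x' in auto)
  also have "- Jmat *\<^sub>v x = - (Jmat *\<^sub>v x)"
    using x by (simp add: uminus_mult_mat_vec)
  also have "Lk P k t *\<^sub>v - (Jmat *\<^sub>v x) = - (Lk P k t *\<^sub>v (Jmat *\<^sub>v x))"
    using carrier_matD[OF Lk_carrier, of P k t] by (intro eq_vecI) simp_all
  finally have 1: "Lk P k t * transpose_mat Jmat *\<^sub>v x = - (Lk P k t *\<^sub>v (Jmat *\<^sub>v x))" .
  have 2: "Jmat * Lk P k t *\<^sub>v x = Jmat *\<^sub>v (Lk P k t *\<^sub>v x)"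
    by (rule assoc_mult_mat_vec[of _ 5 5 _ 5]) (use x' in auto)
  have "(Lk P k t * transpose_mat Jmat + Jmat * Lk P k t) *\<^sub>v x
      = - (Lk P k t *\<^sub>v (Jmat *\<^sub>v x)) + Jmat *\<^sub>v (Lk P k t *\<^sub>v x)"
    using x' 1 2 by (subst add_mult_distrib_mat_vec[of _ 5 5]) (auto intro!: mult_carrier_mat)
  then show ?thesis
    using carrier_matD[OF Lk_carrier, of P k t]
    by (intro eq_vecI) (simp_all add: algebra_simps del: index_mult_mat_vec)
qed

text \<open>Here \<open>x\<close> is the current of one machine, \<open>w\<close> its bus voltage
  and \<open>f\<close> its excitation. After the cancellation the flux enters only through J, whose
  rotor rows are zero; these rows thus contain only resistive drops and \<open>f\<close>, and
  positive damper resistances force the damper currents to vanish.\<close>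

lemma machine_equation_iff:
  assumes x: "dim_vec x = 5" and w: "dim_vec w = 2" and pos: "r_d P k > 0" "r_q P k > 0"
  defines "y \<equiv> vec_first x 2"
  shows "Rk P k *\<^sub>v x + \<omega> \<cdot>\<^sub>v (Lk P k t *\<^sub>v (Jmat *\<^sub>v x)) - (w @\<^sub>v 0\<^sub>v 3) - vec_of_list [0, 0, f, 0, 0]
        + \<omega> \<cdot>\<^sub>v ((Lk P k t * transpose_mat Jmat + Jmat * Lk P k t) *\<^sub>v x) = 0\<^sub>v 5
    \<longleftrightarrow> w - (r_s P k \<cdot>\<^sub>v y + \<omega> \<cdot>\<^sub>v (jmat *\<^sub>v (Lsk P k t *\<^sub>v y)))
          = (\<omega> * l_sf P k * x $ 2) \<cdot>\<^sub>v (jmat *\<^sub>v rot_vec t)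
        \<and> f = r_f P k * x $ 2 \<and> x $ 3 = 0 \<and> x $ 4 = 0" (is "?lhs = 0\<^sub>v 5 \<longleftrightarrow> ?rhs")
proof -
  define z where "z = Lk P k t *\<^sub>v x"
  have dims: "dim_vec z = 5" "dim_vec (Rk P k *\<^sub>v x) = 5" "dim_vec (Lk P k t *\<^sub>v (Jmat *\<^sub>v x)) = 5"
    "dim_row (Lk P k t) = 5"
    using carrier_matD[OF Lk_carrier, of P k t] carrier_matD[OF Rk_carrier, of P k]
    by (simp_all add: z_def)
  let ?f = "vec_of_list [0, 0, f, 0, 0]"
  \<comment> \<open>The two speed-dependent terms are moved next to each other so that the
    cancellation applies.\<close>
  have "?lhs = Rk P k *\<^sub>v x - (w @\<^sub>v 0\<^sub>v 3) - ?f
      + (\<omega> \<cdot>\<^sub>v (Lk P k t *\<^sub>v (Jmat *\<^sub>v x))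
         + \<omega> \<cdot>\<^sub>v ((Lk P k t * transpose_mat Jmat + Jmat * Lk P k t) *\<^sub>v x))"
    using dims w by (intro eq_vecI) (simp_all del: index_mult_mat_vec vec_of_list_Cons)
  also have "\<dots> = Rk P k *\<^sub>v x - (w @\<^sub>v 0\<^sub>v 3) - ?f + \<omega> \<cdot>\<^sub>v (Jmat *\<^sub>v z)"
    by (simp only: induced_voltage_cancel[OF x] z_def)
  finally have lhs: "?lhs = Rk P k *\<^sub>v x - (w @\<^sub>v 0\<^sub>v 3) - ?f + \<omega> \<cdot>\<^sub>v (Jmat *\<^sub>v z)" .
  have "?lhs = 0\<^sub>v 5 \<longleftrightarrow>
      r_s P k * x $ 0 - w $ 0 - \<omega> * z $ Suc 0 = 0 \<and> r_s P k * x $ Suc 0 - w $ Suc 0 + \<omega> * z $ 0 = 0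
      \<and> r_f P k * x $ 2 = f \<and> r_d P k * x $ 3 = 0 \<and> r_q P k * x $ 4 = 0"
    unfolding lhs using dims w x
    by (simp add: vec5_eq_iff Rk_mult_vec Jmat_mult_vec vec_of_list_index
        del: index_mult_mat_vec vec_of_list_Cons)
  also have "\<dots> \<longleftrightarrow> (r_s P k * x $ 0 - w $ 0 - \<omega> * z $ Suc 0 = 0 \<and> r_s P k * x $ Suc 0 - w $ Suc 0 + \<omega> * z $ 0 = 0)
      \<and> f = r_f P k * x $ 2 \<and> x $ 3 = 0 \<and> x $ 4 = 0"
    using pos by auto
  also have "\<dots> \<longleftrightarrow> ?rhs"
  proof -
    \<comment> \<open>The stator rows need comparing only under vanishing damper currents, which
      both sides of the equivalence assert.\<close>
    have "r_s P k * x $ 0 - w $ 0 - \<omega> * z $ Suc 0 = 0 \<and> r_s P k * x $ Suc 0 - w $ Suc 0 + \<omega> * z $ 0 = 0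
      \<longleftrightarrow> w - (r_s P k \<cdot>\<^sub>v y + \<omega> \<cdot>\<^sub>v (jmat *\<^sub>v (Lsk P k t *\<^sub>v y)))
          = (\<omega> * l_sf P k * x $ 2) \<cdot>\<^sub>v (jmat *\<^sub>v rot_vec t)" if "x $ 3 = 0" "x $ 4 = 0"
    proof -
      define s where "s = Lsk P k t *\<^sub>v y"
      have "dim_vec s = 2" "dim_vec y = 2"
        using carrier_matD[OF Lsk_carrier, of P k t] by (simp_all add: s_def y_def)
      moreover have "z $ 0 = s $ 0 + l_sf P k * cos t * x $ 2"
        "z $ Suc 0 = s $ Suc 0 + l_sf P k * sin t * x $ 2"
        using index_Lk_mult_vec[OF x that, of _ P k t]
        by (simp_all add: z_def s_def y_def index_Lmk del: index_mult_mat_vec)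
      moreover have "y $ 0 = x $ 0" "y $ Suc 0 = x $ Suc 0"
        by (simp_all add: y_def vec_first_def)
      ultimately show ?thesis
        using w unfolding s_def[symmetric]
        by (auto simp: vec2_eq_iff index_jmat_mult_vec index_rot_vec algebra_simps
            simp del: index_mult_mat_vec)
    qed
    then show ?thesis by blast
  qed
  finally show ?thesis .
qed

subsection \<open>Steady states as network and machine equations\<close>

lemma stator_selector_carrier: "1\<^sub>m 2 @\<^sub>r 0\<^sub>m 3 2 \<in> carrier_mat 5 (2::nat)"
  using carrier_append_rows[of "1\<^sub>m 2" 2 2 "0\<^sub>m 3 2" 3] by simp

lemma Is_mat_carrier: "Is_mat P \<in> carrier_mat (5 * n_g P) (2 * n_g P)"
  unfolding Is_mat_def by (rule one_kron_carrier[OF stator_selector_carrier])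

lemma dim_is_k [simp]: "dim_vec (is_k i k) = 2"
  by (simp add: is_k_def)

lemma dim_stator_currents [simp]: "dim_vec (stator_currents P i) = 2 * n_g P"
  by (simp add: stator_currents_def)

lemma block_stator_currents: "k < n_g P \<Longrightarrow> block 2 (stator_currents P i) k = is_k i k"
  by (simp add: stator_currents_def block_stack)

lemma transpose_Is_mat_mult_vec:
  assumes i: "dim_vec i = 5 * n_g P"
  shows "transpose_mat (Is_mat P) *\<^sub>v i = stator_currents P i"
proof (rule block_eqI)
  show "dim_vec (transpose_mat (Is_mat P) *\<^sub>v i) = 2 * n_g P"
    using carrier_matD[OF Is_mat_carrier] by simp
  fix k assume k: "k < n_g P"
  have "block 2 (transpose_mat (Is_mat P) *\<^sub>v i) k = transpose_mat (1\<^sub>m 2 @\<^sub>r 0\<^sub>m 3 2) *\<^sub>v block 5 i k"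
    unfolding Is_mat_def transpose_one_kron[OF stator_selector_carrier]
    by (rule block_one_kron_mult_vec) (use i k stator_selector_carrier in auto)
  also have "\<dots> = is_k i k"
    by (simp add: transpose_append_rows_zero_mult_vec[of "1\<^sub>m 2" 2 2] is_k_def)
  finally show "block 2 (transpose_mat (Is_mat P) *\<^sub>v i) k = block 2 (stator_currents P i) k"
    using k by (simp add: block_stator_currents)
qed simp

lemma Iv_mat_mult_vec:
  assumes i: "dim_vec i = 5 * n_g P"
  shows "Iv_mat P *\<^sub>v i = stator_currents P i @\<^sub>v 0\<^sub>v (2 * n_l P)"
  unfolding Iv_mat_def transpose_Is_mat_mult_vec[OF i, symmetric]
  by (rule mult_vec_append_rows_zero)
    (use i Is_mat_carrier in \<open>auto intro: carrier_vecI\<close>)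

lemma transpose_Iv_mat_mult_vec:
  assumes v: "dim_vec v = 2 * n_g P + 2 * n_l P"
  shows "transpose_mat (Iv_mat P) *\<^sub>v v = Is_mat P *\<^sub>v vec_first v (2 * n_g P)"
  unfolding Iv_mat_def
  using transpose_append_rows_zero_mult_vec[OF transpose_carrier_mat[THEN iffD2, OF Is_mat_carrier] v]
  by simp

lemma block_transpose_Iv_mat:
  assumes v: "dim_vec v = 2 * n_g P + 2 * n_l P" and k: "k < n_g P"
  shows "block 5 (transpose_mat (Iv_mat P) *\<^sub>v v) k = block 2 v k @\<^sub>v 0\<^sub>v 3"
proof -
  \<comment> \<open>Generator buses come first, so cutting off the load buses leaves block
    \<open>k\<close> intact.\<close>
  have "block 2 (vec_first v (2 * n_g P)) k = block 2 v k"
    using block_index_less[OF k, of _ 2] by (intro eq_vecI) (auto simp: vec_first_def)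
  moreover have "block 5 (Is_mat P *\<^sub>v vec_first v (2 * n_g P)) k
      = (1\<^sub>m 2 @\<^sub>r 0\<^sub>m 3 2) *\<^sub>v block 2 (vec_first v (2 * n_g P)) k"
    unfolding Is_mat_def
    by (rule block_one_kron_mult_vec) (use k stator_selector_carrier in auto)
  ultimately show ?thesis
    by (simp add: transpose_Iv_mat_mult_vec[OF v] mult_vec_append_rows_zero[of _ 2 2])
qed

lemma field_selector_carrier: "mat_of_cols_list 5 [[0, 0, 1, 0, 0]] \<in> carrier_mat 5 (1::nat)"
  by (intro carrier_matI) (simp_all add: mat_of_cols_list_def)

lemma block_If_mat:
  assumes f: "dim_vec f = n_g P" and k: "k < n_g P"
  shows "block 5 (If_mat P *\<^sub>v f) k = vec_of_list [0, 0, f $ k, 0, 0]"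
proof -
  \<comment> \<open>The field selector has a single column, so the relevant block of
    \<open>f\<close> has length one and holds just \<open>f $ k\<close>.\<close>
  have "block 5 (If_mat P *\<^sub>v f) k = mat_of_cols_list 5 [[0, 0, 1, 0, 0]] *\<^sub>v block 1 f k"
    unfolding If_mat_def
    by (rule block_one_kron_mult_vec[OF field_selector_carrier]) (use f k in auto)
  also have "\<dots> = vec_of_list [0, 0, f $ k, 0, 0]"
    unfolding mat_of_cols_list_def
    by (simp add: vec5_eq_iff vec_of_list_index scalar_prod_def del: vec_of_list_Cons)
  finally show ?thesis .
qed

text \<open>Reconciles the products C J and L J in \<open>rho\<close> with J C and J L in
  \<open>network_set\<close>: in each block a scalar multiple of the identity commutes with
  \<open>jmat\<close>.\<close>

lemma scalar_blocks_jmat_commute: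
  assumes x: "dim_vec x = 2 * n"
  shows "bdiag n (\<lambda>k. c k \<cdot>\<^sub>m 1\<^sub>m 2) *\<^sub>v ((1\<^sub>m n \<otimes>\<^sub>k jmat) *\<^sub>v x)
    = (1\<^sub>m n \<otimes>\<^sub>k jmat) *\<^sub>v (bdiag n (\<lambda>k. c k \<cdot>\<^sub>m 1\<^sub>m 2) *\<^sub>v x)"
proof (rule block_eqI)
  let ?C = "bdiag n (\<lambda>k. c k \<cdot>\<^sub>m 1\<^sub>m 2)" and ?J = "1\<^sub>m n \<otimes>\<^sub>k jmat"
  have C: "?C \<in> carrier_mat (2 * n) (2 * n)" by (rule bdiag_carrier) simp
  have J: "?J \<in> carrier_mat (2 * n) (2 * n)" by (rule one_kron_carrier) simp
  show "dim_vec (?C *\<^sub>v (?J *\<^sub>v x)) = 2 * n" "dim_vec (?J *\<^sub>v (?C *\<^sub>v x)) = 2 * n"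
    using C J by auto
  fix k assume k: "k < n"
  have J_block: "block 2 (?J *\<^sub>v y) k = jmat *\<^sub>v block 2 y k" if "dim_vec y = 2 * n" for y
    by (rule block_one_kron_mult_vec) (use k that in auto)
  have C_block: "block 2 (?C *\<^sub>v y) k = c k \<cdot>\<^sub>m 1\<^sub>m 2 *\<^sub>v block 2 y k" if "dim_vec y = 2 * n" for y
    by (rule block_bdiag_mult_vec) (use k that in auto)
  have scalar: "c k \<cdot>\<^sub>m 1\<^sub>m 2 *\<^sub>v y = c k \<cdot>\<^sub>v y" if "dim_vec y = 2" for y
    using that by (intro eq_vecI) (auto simp: scalar_prod_left_unit[OF carrier_vecI])
  have "block 2 (?C *\<^sub>v (?J *\<^sub>v x)) k = c k \<cdot>\<^sub>v (jmat *\<^sub>v block 2 x k)"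
    using x J by (subst C_block) (auto simp: J_block scalar)
  also have "\<dots> = jmat *\<^sub>v (c k \<cdot>\<^sub>v block 2 x k)"
    by (rule mult_mat_vec[symmetric, of _ 2 2]) auto
  also have "\<dots> = block 2 (?J *\<^sub>v (?C *\<^sub>v x)) k"
    using x C by (subst J_block) (auto simp: C_block scalar)
  finally show "block 2 (?C *\<^sub>v (?J *\<^sub>v x)) k = block 2 (?J *\<^sub>v (?C *\<^sub>v x)) k" .
qed

section \<open>Reduction of the steady-state equations to single machines and the network\<close>

lemma system_matrix_carriers:
  "Rmat P \<in> carrier_mat (5 * n_g P) (5 * n_g P)" "Lmat P \<theta> \<in> carrier_mat (5 * n_g P) (5 * n_g P)"
  "Jg P \<in> carrier_mat (5 * n_g P) (5 * n_g P)" "Cmat P \<in> carrier_mat (2 * n_v P) (2 * n_v P)"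
  "Jv P \<in> carrier_mat (2 * n_v P) (2 * n_v P)" "Yl P v \<in> carrier_mat (2 * n_v P) (2 * n_v P)"
  "RTmat P \<in> carrier_mat (2 * n_t P) (2 * n_t P)" "LTmat P \<in> carrier_mat (2 * n_t P) (2 * n_t P)"
  "JT P \<in> carrier_mat (2 * n_t P) (2 * n_t P)" "Ecal P \<in> carrier_mat (2 * n_v P) (2 * n_t P)"
  unfolding Rmat_def Lmat_def Jg_def Cmat_def Jv_def Yl_def RTmat_def LTmat_def JT_def
  by (auto intro!: bdiag_carrier one_kron_carrier) (auto simp: Ecal_def Einc_def kron_def)

lemma machine_block:
  assumes "admissible P" and i: "dim_vec i = 5 * n_g P" and v: "dim_vec v = 2 * n_v P"
    and f: "dim_vec f = n_g P" and k: "k < n_g P"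
  shows "block 5 ((Rmat P + \<omega>\<^sub>0 \<cdot>\<^sub>m (Lmat P \<theta> * Jg P)) *\<^sub>v i
          - transpose_mat (Iv_mat P) *\<^sub>v v - If_mat P *\<^sub>v f + v_ind P \<theta> \<omega> i) k
    = Rk P k *\<^sub>v block 5 i k + \<omega>\<^sub>0 \<cdot>\<^sub>v (Lk P k (\<theta> $ k) *\<^sub>v (Jmat *\<^sub>v block 5 i k))
        - (block 2 v k @\<^sub>v 0\<^sub>v 3) - vec_of_list [0, 0, f $ k, 0, 0]
        + \<omega> $ k \<cdot>\<^sub>v ((Lk P k (\<theta> $ k) * transpose_mat Jmat + Jmat * Lk P k (\<theta> $ k)) *\<^sub>v block 5 i k)"
proof -
  note carr = carrier_matD[OF system_matrix_carriers(1)] carrier_matD[OF system_matrix_carriers(2)]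
    carrier_matD[OF system_matrix_carriers(3)]
  \<comment> \<open>Since \<open>n_l\<close> is a difference of natural numbers, admissibility is
    what makes the dimensions add up.\<close>
  have v': "dim_vec v = 2 * n_g P + 2 * n_l P"
    using assms(1) v by (auto simp: admissible_def n_l_def)
  have dims: "dim_vec (transpose_mat (Iv_mat P) *\<^sub>v v) = 5 * n_g P"
    "dim_vec (If_mat P *\<^sub>v f) = 5 * n_g P" "dim_vec (v_ind P \<theta> \<omega> i) = 5 * n_g P"
    using carrier_matD[OF Is_mat_carrier] one_kron_carrier[OF field_selector_carrier, of "n_g P"]
    by (auto simp: transpose_Iv_mat_mult_vec[OF v'] If_mat_def v_ind_def)
  have 1: "(Rmat P + \<omega>\<^sub>0 \<cdot>\<^sub>m (Lmat P \<theta> * Jg P)) *\<^sub>v i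
      = Rmat P *\<^sub>v i + \<omega>\<^sub>0 \<cdot>\<^sub>v (Lmat P \<theta> *\<^sub>v (Jg P *\<^sub>v i))"
    by (rule add_smult_mult_mult_vec[OF system_matrix_carriers(1,2,3)]) (use i in \<open>rule carrier_vecI\<close>)
  have R: "block 5 (Rmat P *\<^sub>v i) k = Rk P k *\<^sub>v block 5 i k"
    unfolding Rmat_def by (rule block_bdiag_mult_vec) (use i k in auto)
  have L: "block 5 (Lmat P \<theta> *\<^sub>v y) k = Lk P k (\<theta> $ k) *\<^sub>v block 5 y k" if "dim_vec y = 5 * n_g P" for y
    unfolding Lmat_def by (rule block_bdiag_mult_vec) (use that k in auto)
  have J: "block 5 (Jg P *\<^sub>v i) k = Jmat *\<^sub>v block 5 i k"
    unfolding Jg_def by (rule block_one_kron_mult_vec) (use i k in auto)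
  have "dim_vec (v_indk P k \<theta> \<omega> i) = 5"
    by (simp add: v_indk_def)
  then have "block 5 (v_ind P \<theta> \<omega> i) k = v_indk P k \<theta> \<omega> i"
    using k by (simp add: v_ind_def block_stack)
  then show ?thesis
    using k dims carr
    by (simp add: 1 block_add block_minus block_smult R L J block_transpose_Iv_mat[OF v' k]
        block_If_mat[OF f k] v_indk_def del: vec_of_list_Cons)
qed

text \<open>The assumption on \<open>\<omega> $ k\<close> comes from the first row of
  \<open>rho\<close> and makes the two speeds in the machine equation coincide.\<close>

lemma machine_steady_iff:
  assumes adm: "admissible P" and i: "dim_vec i = 5 * n_g P" and v: "dim_vec v = 2 * n_v P"
    and f: "dim_vec f = n_g P" and k: "k < n_g P" and \<omega>: "\<omega> $ k = \<omega>\<^sub>0"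
  shows "block 5 ((Rmat P + \<omega>\<^sub>0 \<cdot>\<^sub>m (Lmat P \<theta> * Jg P)) *\<^sub>v i
          - transpose_mat (Iv_mat P) *\<^sub>v v - If_mat P *\<^sub>v f + v_ind P \<theta> \<omega> i) k = 0\<^sub>v 5
    \<longleftrightarrow> nu P \<omega>\<^sub>0 k (\<theta> $ k) v (stator_currents P i)
          = (\<omega>\<^sub>0 * l_sf P k * if_k i k) \<cdot>\<^sub>v (jmat *\<^sub>v rot_vec (\<theta> $ k))
        \<and> f $ k = r_f P k * if_k i k \<and> id_k i k = 0 \<and> iq_k i k = 0"
proof -
  have pos: "r_d P k > 0" "r_q P k > 0" using adm k by (auto simp: admissible_def)
  show ?thesis
    unfolding machine_block[OF adm i v f k] \<omega> nu_eq block_stator_currents[OF k]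
      is_k_def if_k_def id_k_def iq_k_def
    by (rule machine_equation_iff) (use pos in simp_all)
qed

text \<open>The last two rows of \<open>rho\<close> see the machines only through the stator
  currents; the rest is commuting the J factors and reordering summands.\<close>

lemma network_rows_iff:
  assumes adm: "admissible P" and i: "dim_vec i = 5 * n_g P" and v: "dim_vec v = 2 * n_v P"
    and iT: "dim_vec iT = 2 * n_t P"
  shows "(stator_currents P i, v, iT) \<in> network_set P \<omega>\<^sub>0 \<longleftrightarrow>
    (\<omega>\<^sub>0 \<cdot>\<^sub>m (Cmat P * Jv P)) *\<^sub>v v + Iv_mat P *\<^sub>v i + Ecal P *\<^sub>v iT + il P v = 0\<^sub>v (2 * n_v P) \<and>
    (RTmat P + \<omega>\<^sub>0 \<cdot>\<^sub>m (LTmat P * JT P)) *\<^sub>v iT - transpose_mat (Ecal P) *\<^sub>v v = 0\<^sub>v (2 * n_t P)"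
proof -
  note carr = system_matrix_carriers
  have v': "v \<in> carrier_vec (2 * n_v P)" and iT': "iT \<in> carrier_vec (2 * n_t P)"
    using v iT by (auto intro: carrier_vecI)
  have nl: "2 * n_g P + 2 * n_l P = 2 * n_v P" using adm by (auto simp: admissible_def n_l_def)
  have CJ: "Cmat P *\<^sub>v (Jv P *\<^sub>v v) = Jv P *\<^sub>v (Cmat P *\<^sub>v v)"
    unfolding Cmat_def Jv_def by (rule scalar_blocks_jmat_commute[OF v])
  have LJ: "LTmat P *\<^sub>v (JT P *\<^sub>v iT) = JT P *\<^sub>v (LTmat P *\<^sub>v iT)"
    unfolding LTmat_def JT_def by (rule scalar_blocks_jmat_commute[OF iT])
  have "(\<omega>\<^sub>0 \<cdot>\<^sub>m (Cmat P * Jv P)) *\<^sub>v v = \<omega>\<^sub>0 \<cdot>\<^sub>v (Cmat P * Jv P *\<^sub>v v)"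
    using v carr[of P] by (intro eq_vecI) (auto simp del: assoc_mult_mat_vec)
  then have 1: "(\<omega>\<^sub>0 \<cdot>\<^sub>m (Cmat P * Jv P)) *\<^sub>v v = \<omega>\<^sub>0 \<cdot>\<^sub>v (Jv P *\<^sub>v (Cmat P *\<^sub>v v))"
    using v' carr by (simp add: assoc_mult_mat_vec[OF carr(4,5)] CJ)
  have 2: "(Yl P v + \<omega>\<^sub>0 \<cdot>\<^sub>m (Jv P * Cmat P)) *\<^sub>v v = Yl P v *\<^sub>v v + \<omega>\<^sub>0 \<cdot>\<^sub>v (Jv P *\<^sub>v (Cmat P *\<^sub>v v))"
    by (rule add_smult_mult_mult_vec[OF carr(6,5,4) v'])
  have bus: "(\<omega>\<^sub>0 \<cdot>\<^sub>m (Cmat P * Jv P)) *\<^sub>v v + Iv_mat P *\<^sub>v i + Ecal P *\<^sub>v iT + il P v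
      = (Yl P v + \<omega>\<^sub>0 \<cdot>\<^sub>m (Jv P * Cmat P)) *\<^sub>v v + (stator_currents P i @\<^sub>v 0\<^sub>v (2 * n_l P)) + Ecal P *\<^sub>v iT"
    unfolding 1 2 Iv_mat_mult_vec[OF i] il_def
    using carrier_matD[OF carr(5)] carrier_matD[OF carr(6)] carrier_matD[OF carr(10)] nl
    by (intro eq_vecI) (simp_all del: index_mult_mat_vec index_append_vec(1))
  have line: "(RTmat P + \<omega>\<^sub>0 \<cdot>\<^sub>m (LTmat P * JT P)) *\<^sub>v iT = (RTmat P + \<omega>\<^sub>0 \<cdot>\<^sub>m (JT P * LTmat P)) *\<^sub>v iT"
    unfolding add_smult_mult_mult_vec[OF carr(7,8,9) iT'] add_smult_mult_mult_vec[OF carr(7,9,8) iT'] LJ ..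
  have "stator_currents P i \<in> carrier_vec (2 * n_g P)" by (rule carrier_vecI) simp
  then show ?thesis
    unfolding bus line network_set_def network_space_def using v' iT' by auto
qed

text \<open>Decouples the equations into a network condition and one condition per generator. All
  three claims of the theorem rest on it.\<close>

lemma steady_states_iff:
  assumes adm: "admissible P"
  shows "((\<theta>, \<omega>, i, v, iT), (\<tau>, f)) \<in> steady_states P \<omega>\<^sub>0 \<longleftrightarrow>
    (\<theta>, \<omega>, i, v, iT) \<in> states P \<and> (\<tau>, f) \<in> inputs P \<and>
    (stator_currents P i, v, iT) \<in> network_set P \<omega>\<^sub>0 \<and>
    (\<forall>k<n_g P. \<omega> $ k = \<omega>\<^sub>0 \<and> \<tau> $ k = damp P k * \<omega>\<^sub>0 + tau_ek P k \<theta> i \<and>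
       nu P \<omega>\<^sub>0 k (\<theta> $ k) v (stator_currents P i)
          = (\<omega>\<^sub>0 * l_sf P k * if_k i k) \<cdot>\<^sub>v (jmat *\<^sub>v rot_vec (\<theta> $ k)) \<and>
       f $ k = r_f P k * if_k i k \<and> id_k i k = 0 \<and> iq_k i k = 0)"
proof (cases "(\<theta>, \<omega>, i, v, iT) \<in> states P \<and> (\<tau>, f) \<in> inputs P")
  case False
  then show ?thesis by (auto simp: steady_states_def)
next
  case True
  then have dims: "dim_vec \<omega> = n_g P" "dim_vec i = 5 * n_g P" "dim_vec v = 2 * n_v P"
    "dim_vec iT = 2 * n_t P" "dim_vec \<tau> = n_g P" "dim_vec f = n_g P"
    by (auto simp: states_def inputs_def)
  let ?s = "\<omega>\<^sub>0 \<cdot>\<^sub>v vec (n_g P) (\<lambda>_. 1) - \<omega>"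
  let ?t = "Dmat P *\<^sub>v \<omega> + tau_e P \<theta> i - \<tau>"
  let ?m = "(Rmat P + \<omega>\<^sub>0 \<cdot>\<^sub>m (Lmat P \<theta> * Jg P)) *\<^sub>v i
          - transpose_mat (Iv_mat P) *\<^sub>v v - If_mat P *\<^sub>v f + v_ind P \<theta> \<omega> i"
  let ?b = "(\<omega>\<^sub>0 \<cdot>\<^sub>m (Cmat P * Jv P)) *\<^sub>v v + Iv_mat P *\<^sub>v i + Ecal P *\<^sub>v iT + il P v"
  let ?l = "(RTmat P + \<omega>\<^sub>0 \<cdot>\<^sub>m (LTmat P * JT P)) *\<^sub>v iT - transpose_mat (Ecal P) *\<^sub>v v"
  have D: "Dmat P *\<^sub>v \<omega> = vec (n_g P) (\<lambda>k. damp P k * \<omega> $ k)"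
    unfolding Dmat_def mat_diag_def
    by (intro eq_vecI) (auto simp: scalar_prod_def dims if_distrib[of "\<lambda>c. c * _"] cong: if_cong)
  have s: "?s = 0\<^sub>v (n_g P) \<longleftrightarrow> (\<forall>k<n_g P. \<omega> $ k = \<omega>\<^sub>0)"
    using dims by (auto simp: vec_eq_iff)
  have t: "?t = 0\<^sub>v (n_g P) \<longleftrightarrow> (\<forall>k<n_g P. \<tau> $ k = damp P k * \<omega> $ k + tau_ek P k \<theta> i)"
    using dims by (auto simp: vec_eq_iff D tau_e_def)
  \<comment> \<open>The dimension of \<open>?m\<close> is that of its last summand, the induced
    voltage.\<close>
  have m: "?m = 0\<^sub>v (5 * n_g P) \<longleftrightarrow> (\<forall>k<n_g P. block 5 ?m k = 0\<^sub>v 5)"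
    by (rule zero_vec_iff_blocks) (simp add: v_ind_def)
  have dim_s: "dim_vec ?s = n_g P" and dim_t: "dim_vec ?t = n_g P" and dim_m: "dim_vec ?m = 5 * n_g P"
    using dims by (simp_all add: v_ind_def)
  have dim_b: "dim_vec ?b = 2 * n_v P"
    using carrier_matD[OF system_matrix_carriers(6), of P v] by (simp add: il_def)
  have dim_l: "dim_vec ?l = 2 * n_t P"
    using carrier_matD[OF system_matrix_carriers(10), of P] by simp
  have "rho P (\<theta>, \<omega>, i, v, iT) (\<tau>, f) \<omega>\<^sub>0 = ?s @\<^sub>v ?t @\<^sub>v ?m @\<^sub>v ?b @\<^sub>v ?l"
    by (simp add: rho_def)
  moreover have "?s @\<^sub>v ?t @\<^sub>v ?m @\<^sub>v ?b @\<^sub>v ?l = 0\<^sub>v (n_g P + (n_g P + (5 * n_g P + (2 * n_v P + 2 * n_t P))))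
      \<longleftrightarrow> ?s = 0\<^sub>v (n_g P) \<and> ?t = 0\<^sub>v (n_g P) \<and> ?m = 0\<^sub>v (5 * n_g P) \<and> ?b = 0\<^sub>v (2 * n_v P) \<and> ?l = 0\<^sub>v (2 * n_t P)"
    by (simp only: append_vec_eq_zero_iff index_append_vec(2) dim_s dim_t dim_m dim_b dim_l)
  ultimately have "((\<theta>, \<omega>, i, v, iT), (\<tau>, f)) \<in> steady_states P \<omega>\<^sub>0 \<longleftrightarrow>
      ?s = 0\<^sub>v (n_g P) \<and> ?t = 0\<^sub>v (n_g P) \<and> ?m = 0\<^sub>v (5 * n_g P) \<and> (stator_currents P i, v, iT) \<in> network_set P \<omega>\<^sub>0"
    using True unfolding network_rows_iff[OF adm dims(2-4)]
    by (simp add: steady_states_def add.assoc)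
  \<comment> \<open>The speed row is used twice: to replace \<open>\<omega> $ k\<close> by
    \<open>\<omega>\<^sub>0\<close> in the torque balance and to simplify the machine
    equation.\<close>
  then show ?thesis
    using True unfolding s t m
    by (auto simp: machine_steady_iff[OF adm dims(2,3,6)])
qed

subsection \<open>Existence of steady states\<close>

lemma machine_currents_of_block:
  assumes "block 5 i k = vec_of_list [x $ 0, x $ Suc 0, a, 0, 0]" "dim_vec x = 2"
  shows "is_k i k = x" "if_k i k = a" "id_k i k = 0" "iq_k i k = 0"
  using assms
  by (simp_all add: is_k_def if_k_def id_k_def iq_k_def vec2_eq_iff vec_first_def vec_of_list_index
      del: vec_of_list_Cons)

text \<open>
  The saliency term is \<open>R(2\<theta>)\<close> times a reflection. Projected onto \<open>r(\<theta>)\<close> it leaves a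
  single angle, so \<open>r(\<theta>) \<bullet> \<nu>(\<theta>) = r(\<theta>) \<bullet> w\<close> with \<open>w = (w0, w1)\<close> independent of \<open>\<theta>\<close>.
\<close>

lemma exists_rotor_angle:
  "\<exists>t c. nu P \<omega>\<^sub>0 k t v i\<^sub>s = c \<cdot>\<^sub>v (jmat *\<^sub>v rot_vec t)"
proof -
  define x y where "x = block 2 v k" and "y = block 2 i\<^sub>s k"
  \<comment> \<open>The vector (\<open>w0\<close>, \<open>w1\<close>) is \<open>nu\<close> with the
    stator inductance matrix replaced by \<open>l_s - l_sa\<close> times the identity.\<close>
  define w0 where "w0 = x $ 0 - r_s P k * y $ 0 + \<omega>\<^sub>0 * (l_s P k - l_sa P k) * y $ Suc 0"
  define w1 where "w1 = x $ Suc 0 - r_s P k * y $ Suc 0 - \<omega>\<^sub>0 * (l_s P k - l_sa P k) * y $ 0"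
  obtain \<rho> a where polar: "w0 = \<rho> * cos a" "w1 = \<rho> * sin a" using polar_Ex[of w0 w1] by blast
  \<comment> \<open>A quarter turn from the direction of w, so r(t) is orthogonal to w, also when w
    = 0.\<close>
  define t where "t = a + pi / 2"
  have t: "cos t * w0 + sin t * w1 = 0"
    by (simp add: t_def polar cos_add sin_add)
  let ?\<nu> = "nu P \<omega>\<^sub>0 k t v i\<^sub>s"
  define n0 n1 where "n0 = ?\<nu> $ 0" and "n1 = ?\<nu> $ Suc 0"
  have n0: "n0 = x $ 0 - r_s P k * y $ 0
      + \<omega>\<^sub>0 * (l_s P k * y $ Suc 0 + l_sa P k * (sin (2 * t) * y $ 0 - cos (2 * t) * y $ Suc 0))"
    unfolding n0_def index_nu x_def y_def by (subst index_Lsk_mult_vec) simp_all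
  have n1: "n1 = x $ Suc 0 - r_s P k * y $ Suc 0
      - \<omega>\<^sub>0 * (l_s P k * y $ 0 + l_sa P k * (cos (2 * t) * y $ 0 + sin (2 * t) * y $ Suc 0))"
    unfolding n1_def index_nu x_def y_def by (subst index_Lsk_mult_vec) simp_all
  have "sin (2 * t) * cos t - cos (2 * t) * sin t = sin t" "cos (2 * t) * cos t + sin (2 * t) * sin t = cos t"
    using sin_diff[of "2 * t" t] cos_diff[of "2 * t" t] by simp_all
  \<comment> \<open>The projections of \<open>nu\<close> and w onto r(t) differ only by multiples of
    terms that vanish by the two angle-difference identities.\<close>
  moreover have "cos t * n0 + sin t * n1 = cos t * w0 + sin t * w1
      + \<omega>\<^sub>0 * l_sa P k * (y $ 0 * (sin (2 * t) * cos t - cos (2 * t) * sin t - sin t)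
        - y $ Suc 0 * (cos (2 * t) * cos t + sin (2 * t) * sin t - cos t))"
    unfolding n0 n1 w0_def w1_def by (simp add: algebra_simps)
  ultimately have orth: "cos t * n0 + sin t * n1 = 0" using t by simp
  \<comment> \<open>The coordinate of \<open>nu\<close> along j r(t) = (-sin t, cos t). The
    expansion in the orthonormal basis r(t), j r(t) follows, written as a polynomial identity with
    the defect of sin^2 + cos^2 = 1 kept explicit.\<close>
  define c where "c = cos t * n1 - sin t * n0"
  have "n0 - c * (- sin t) = n0 * (1 - ((sin t)\<^sup>2 + (cos t)\<^sup>2)) + cos t * (cos t * n0 + sin t * n1)"
    "n1 - c * cos t = n1 * (1 - ((sin t)\<^sup>2 + (cos t)\<^sup>2)) + sin t * (cos t * n0 + sin t * n1)"
    unfolding c_def power2_eq_square by (simp_all only: algebra_simps)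
  then have "n0 = c * (- sin t)" "n1 = c * cos t"
    unfolding orth sin_cos_squared_add by simp_all
  then have "?\<nu> = c \<cdot>\<^sub>v (jmat *\<^sub>v rot_vec t)"
    unfolding n0_def n1_def
    by (simp add: vec2_eq_iff index_jmat_mult_vec index_rot_vec del: index_mult_mat_vec)
  then show ?thesis by blast
qed

lemma exists_steady_state:
  assumes adm: "admissible P" and "\<omega>\<^sub>0 \<noteq> 0" and net: "(i\<^sub>s, v, iT) \<in> network_set P \<omega>\<^sub>0"
  shows "\<exists>\<theta> \<omega> i u. stator_currents P i = i\<^sub>s \<and> ((\<theta>, \<omega>, i, v, iT), u) \<in> steady_states P \<omega>\<^sub>0"
proof -
  have "\<forall>k. \<exists>t c. nu P \<omega>\<^sub>0 k t v i\<^sub>s = c \<cdot>\<^sub>v (jmat *\<^sub>v rot_vec t)"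
    by (intro allI exists_rotor_angle)
  then obtain t c where tc: "\<And>k. nu P \<omega>\<^sub>0 k (t k) v i\<^sub>s = c k \<cdot>\<^sub>v (jmat *\<^sub>v rot_vec (t k))"
    by metis
  \<comment> \<open>The field current that produces the required coefficient of j r(t); a nonzero
    \<open>\<omega>\<^sub>0\<close> is essential here.\<close>
  define a where "a k = c k / (\<omega>\<^sub>0 * l_sf P k)" for k
  define i where "i = stack 5 (n_g P) (\<lambda>k. vec_of_list [i\<^sub>s $ (k * 2), i\<^sub>s $ (k * 2 + 1), a k, 0, 0])"
  define \<theta> where "\<theta> = vec (n_g P) t"
  define \<omega> where "\<omega> = vec (n_g P) (\<lambda>_. \<omega>\<^sub>0)"
  \<comment> \<open>With angles and currents fixed, each input appears linearly in its own equation
    and is solved for.\<close>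
  define \<tau> where "\<tau> = vec (n_g P) (\<lambda>k. damp P k * \<omega>\<^sub>0 + tau_ek P k \<theta> i)"
  define f where "f = vec (n_g P) (\<lambda>k. r_f P k * a k)"
  have dims: "dim_vec i\<^sub>s = 2 * n_g P" "dim_vec v = 2 * n_v P" "dim_vec iT = 2 * n_t P"
    using net by (auto simp: network_set_def network_space_def)
  have "block 5 i k = vec_of_list [block 2 i\<^sub>s k $ 0, block 2 i\<^sub>s k $ Suc 0, a k, 0, 0]" if "k < n_g P" for k
    using that by (simp add: i_def block_stack)
  note comp = machine_currents_of_block[OF this dim_block]
  have st: "stator_currents P i = i\<^sub>s"
    by (rule block_eqI[of _ 2 "n_g P"]) (use dims in \<open>simp_all add: block_stator_currents comp\<close>)
  have "\<omega>\<^sub>0 * l_sf P k * a k = c k" if "k < n_g P" for k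
    using adm that \<open>\<omega>\<^sub>0 \<noteq> 0\<close> by (auto simp: admissible_def a_def)
  moreover have "(\<theta>, \<omega>, i, v, iT) \<in> states P" "(\<tau>, f) \<in> inputs P"
    unfolding states_def inputs_def using dims
    by (intro SigmaI carrier_vecI; simp add: \<theta>_def \<omega>_def \<tau>_def f_def i_def)+
  ultimately have "((\<theta>, \<omega>, i, v, iT), (\<tau>, f)) \<in> steady_states P \<omega>\<^sub>0"
    using net by (simp add: steady_states_iff[OF adm] st comp tc \<theta>_def \<omega>_def \<tau>_def f_def)
  with st show ?thesis by blast
qed

text \<open>Existence is claimed for nonzero \<open>\<omega>\<^sub>0\<close> because it fails at
  zero: the stator equation becomes v_k = r_s i_s, which the network need not satisfy. One generator
  bus without lines and with zero load admits i_s = 0 and any nonzero voltage.\<close>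

theorem theorem5:
  fixes P :: power_system and \<omega>\<^sub>0 :: real
  assumes "admissible P"
  shows
   "(\<forall>i\<^sub>s v i\<^sub>T. (i\<^sub>s, v, i\<^sub>T) \<in> network_space P \<longrightarrow> (i\<^sub>s, v, i\<^sub>T) \<notin> network_set P \<omega>\<^sub>0 \<longrightarrow>
       \<not> (\<exists>\<theta> \<omega> i u. stator_currents P i = i\<^sub>s \<and> ((\<theta>, \<omega>, i, v, i\<^sub>T), u) \<in> steady_states P \<omega>\<^sub>0))
    \<and>
    (\<omega>\<^sub>0 \<noteq> 0 \<longrightarrow>
     (\<forall>i\<^sub>s v i\<^sub>T. (i\<^sub>s, v, i\<^sub>T) \<in> network_set P \<omega>\<^sub>0 \<longrightarrow>
       (\<exists>\<theta> \<omega> i u. stator_currents P i = i\<^sub>s \<and> ((\<theta>, \<omega>, i, v, i\<^sub>T), u) \<in> steady_states P \<omega>\<^sub>0)))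
    \<and>
    (\<forall>i\<^sub>s v i\<^sub>T \<theta> \<omega> i \<tau>\<^sub>m v\<^sub>f. (i\<^sub>s, v, i\<^sub>T) \<in> network_set P \<omega>\<^sub>0 \<longrightarrow> stator_currents P i = i\<^sub>s \<longrightarrow>
       ((\<theta>, \<omega>, i, v, i\<^sub>T), (\<tau>\<^sub>m, v\<^sub>f)) \<in> steady_states P \<omega>\<^sub>0 \<longrightarrow>
       (\<forall>k<n_g P.
          (\<exists>\<sigma>\<in>{-1, 1}.
             \<omega>\<^sub>0 * l_sf P k * if_k i k = \<sigma> * vnorm (nu P \<omega>\<^sub>0 k (\<theta> $ k) v i\<^sub>s) \<and>
             vnorm (nu P \<omega>\<^sub>0 k (\<theta> $ k) v i\<^sub>s) \<cdot>\<^sub>v (jmat *\<^sub>v rot_vec (\<theta> $ k))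
               = \<sigma> \<cdot>\<^sub>v nu P \<omega>\<^sub>0 k (\<theta> $ k) v i\<^sub>s) \<and>
          \<omega> $ k = \<omega>\<^sub>0 \<and> id_k i k = 0 \<and> iq_k i k = 0 \<and>
          v\<^sub>f $ k = r_f P k * if_k i k \<and>
          \<tau>\<^sub>m $ k = damp P k * \<omega>\<^sub>0 + tau_ek P k \<theta> i))"
proof (intro conjI allI impI notI)
  fix i\<^sub>s v i\<^sub>T
  assume "(i\<^sub>s, v, i\<^sub>T) \<notin> network_set P \<omega>\<^sub>0"
    and "\<exists>\<theta> \<omega> i u. stator_currents P i = i\<^sub>s \<and> ((\<theta>, \<omega>, i, v, i\<^sub>T), u) \<in> steady_states P \<omega>\<^sub>0"
  then show False by (auto simp: steady_states_iff[OF assms])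
next
  fix i\<^sub>s v i\<^sub>T
  assume "\<omega>\<^sub>0 \<noteq> 0" "(i\<^sub>s, v, i\<^sub>T) \<in> network_set P \<omega>\<^sub>0"
  then show "\<exists>\<theta> \<omega> i u. stator_currents P i = i\<^sub>s \<and> ((\<theta>, \<omega>, i, v, i\<^sub>T), u) \<in> steady_states P \<omega>\<^sub>0"
    by (rule exists_steady_state[OF assms])
next
  fix i\<^sub>s v i\<^sub>T \<theta> \<omega> i \<tau>\<^sub>m v\<^sub>f k
  assume st: "stator_currents P i = i\<^sub>s" and k: "k < n_g P"
    and steady: "((\<theta>, \<omega>, i, v, i\<^sub>T), (\<tau>\<^sub>m, v\<^sub>f)) \<in> steady_states P \<omega>\<^sub>0"
  note machine = steady[unfolded steady_states_iff[OF assms], THEN conjunct2, THEN conjunct2,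
      THEN conjunct2, rule_format, OF k, unfolded st]
  then show "\<omega> $ k = \<omega>\<^sub>0" "id_k i k = 0" "iq_k i k = 0" "v\<^sub>f $ k = r_f P k * if_k i k"
    "\<tau>\<^sub>m $ k = damp P k * \<omega>\<^sub>0 + tau_ek P k \<theta> i"
    by simp_all
  let ?c = "\<omega>\<^sub>0 * l_sf P k * if_k i k" and ?\<nu> = "nu P \<omega>\<^sub>0 k (\<theta> $ k) v i\<^sub>s"
  \<comment> \<open>The polarization is the sign of the coefficient of j r(theta). If that is zero,
    \<open>nu\<close> vanishes and either sign would do; 1 is taken.\<close>
  let ?\<sigma> = "if ?c \<ge> 0 then 1 else - 1 :: real"
  have \<nu>: "?\<nu> = ?c \<cdot>\<^sub>v (jmat *\<^sub>v rot_vec (\<theta> $ k))" using machine by simp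
  have norm: "vnorm ?\<nu> = \<bar>?c\<bar>" by (simp add: \<nu> vnorm_smult vnorm_jmat_rot_vec)
  show "\<exists>\<sigma>\<in>{-1, 1}. ?c = \<sigma> * vnorm ?\<nu> \<and> vnorm ?\<nu> \<cdot>\<^sub>v (jmat *\<^sub>v rot_vec (\<theta> $ k)) = \<sigma> \<cdot>\<^sub>v ?\<nu>"
  proof (rule bexI[of _ ?\<sigma>], intro conjI)
    show "?c = ?\<sigma> * vnorm ?\<nu>" by (simp add: norm)
    have "\<bar>?c\<bar> = ?\<sigma> * ?c" by (simp add: abs_if)
    then show "vnorm ?\<nu> \<cdot>\<^sub>v (jmat *\<^sub>v rot_vec (\<theta> $ k)) = ?\<sigma> \<cdot>\<^sub>v ?\<nu>"
      unfolding norm by (simp only: \<nu> smult_smult_assoc)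
  qed simp
qed

end
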